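(* There exists a constant $c$ such that for every even positive integer $n$ the following holds: if $M^<$ is an ordered matching on $n$ vertices with $\chi_<(M^<)=2$ chosen uniformly at random among all such ordered matchings, then with high probability (i.e., with probability tending to $1$ as $n\to\infty$) \[ r_<(M^<,K_3^<) \leq c\,n^{7/4}. \]
   Context: An ordered graph $G^<$ is a graph together with a linear ordering of its vertex set. An ordered graph $G^<$ is an ordered subgraph of $H^<$ if $G$ is a subgraph of $H$ and the vertex ordering of $G$ is the restriction of that of $H$. An ordered matching is a $1$-regular ordered graph. $K_N^<$ denotes the complete graph on $[N]=\{1,\dots,N\}$ with the natural order. The ordered Ramsey number $r_<(G^<,H^<)$ is the smallest positive integer $N$ such that every red-blue coloring of the edges of $K_N^<$ contains a red copy of $G^<$ (an ordered subgraph isomorphic to $G^<$ as ordered graphs, all of whose edges are red) or a blue copy of $H^<$. The interval chromatic number $\chi_<(G^<)$ is the minimum number of intervals (sets of consecutive vertices) into which the vertex set can be partitioned so that no edge has both endpoints in the same interval. *)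

theory Defs
  imports "HOL-Library.Ramsey" "HOL-Library.Disjoint_Sets" "HOL-Probability.Probability"
begin

text \<open>A graph is a pair of a vertex set and a set of two-element edges. The linear ordering of the
  vertex set is always the restriction of the order of the underlying \<open>linorder\<close> type; in particular
  every subgraph is automatically an ordered subgraph.\<close>

type_synonym 'a ograph = "'a set \<times> 'a set set"

abbreviation verts :: "'a ograph \<Rightarrow> 'a set" where "verts \<equiv> fst"
abbreviation edges :: "'a ograph \<Rightarrow> 'a set set" where "edges \<equiv> snd"

definition ordered_graph :: "('a::linorder) ograph \<Rightarrow> bool" where
  "ordered_graph G \<longleftrightarrow> finite (verts G) \<and> edges G \<subseteq> nsets (verts G) 2"

definition ordered_subgraph :: "('a::linorder) ograph \<Rightarrow> 'a ograph \<Rightarrow> bool" where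
  "ordered_subgraph G H \<longleftrightarrow>
     ordered_graph G \<and> ordered_graph H \<and> verts G \<subseteq> verts H \<and> edges G \<subseteq> edges H"

definition ordered_iso :: "('a::linorder) ograph \<Rightarrow> ('b::linorder) ograph \<Rightarrow> bool" where
  "ordered_iso G H \<longleftrightarrow>
     (\<exists>f. bij_betw f (verts G) (verts H) \<and> strict_mono_on (verts G) f
        \<and> edges H = (\<lambda>e. f ` e) ` edges G)"

definition complete_ograph :: "nat \<Rightarrow> nat ograph" where
  "complete_ograph N = ({1..N}, nsets {1..N} 2)"

definition ordered_matching :: "('a::linorder) ograph \<Rightarrow> bool" where
  "ordered_matching G \<longleftrightarrow>
     ordered_graph G \<and> (\<forall>v\<in>verts G. card {e \<in> edges G. v \<in> e} = 1)"

datatype colour = Red | Blue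

definition mono_copy ::
  "(nat set \<Rightarrow> colour) \<Rightarrow> colour \<Rightarrow> ('a::linorder) ograph \<Rightarrow> nat \<Rightarrow> bool" where
  "mono_copy col c G N \<longleftrightarrow>
     (\<exists>H. ordered_subgraph H (complete_ograph N) \<and> ordered_iso G H \<and> (\<forall>e\<in>edges H. col e = c))"

definition ordered_ramsey :: "('a::linorder) ograph \<Rightarrow> ('b::linorder) ograph \<Rightarrow> nat" where
  "ordered_ramsey G H =
     (LEAST N. 0 < N \<and> (\<forall>col. mono_copy col Red G N \<or> mono_copy col Blue H N))"

definition interval_of :: "('a::linorder) set \<Rightarrow> 'a set \<Rightarrow> bool" where
  "interval_of V I \<longleftrightarrow> I \<subseteq> V \<and> (\<forall>x\<in>I. \<forall>z\<in>I. \<forall>y\<in>V. x < y \<and> y < z \<longrightarrow> y \<in> I)"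

definition interval_chromatic_number :: "('a::linorder) ograph \<Rightarrow> nat" where
  "interval_chromatic_number G =
     (LEAST k. \<exists>P. partition_on (verts G) P \<and> finite P \<and> card P = k
        \<and> (\<forall>I\<in>P. interval_of (verts G) I \<and> (\<forall>e\<in>edges G. \<not> e \<subseteq> I)))"

text \<open>Up to order isomorphism, an ordered graph on \<open>n\<close> vertices lives on \<open>{1..n}\<close>, and this
  representative is unique.\<close>

definition matchings2 :: "nat \<Rightarrow> nat ograph set" where
  "matchings2 n =
     {M. ordered_matching M \<and> verts M = {1..n} \<and> interval_chromatic_number M = 2}"

lemma finite_matchings2: "finite (matchings2 n)"
proof -
  have "matchings2 n \<subseteq> {{1..n}} \<times> Pow (Pow {1..n})"
    by (fastforce simp: matchings2_def ordered_matching_def ordered_graph_def nsets_def)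
  then show ?thesis by (rule finite_subset) auto
qed
lemma matchings2_nonempty: "m > 0 \<Longrightarrow> matchings2 (2*m) \<noteq> {}"
proof -
  assume m: "m > 0"
  define E where "E = (\<lambda>i. {i, m+i}) ` {1..m}"
  define M where "M = ({1..2*m}, E)"
  have og: "ordered_graph M" using m by (auto simp: ordered_graph_def M_def E_def nsets_def)
  have aux: "\<exists>x\<in>{Suc 0..m}. {v - m, v} = {x, m + x}" if "v \<le> 2*m" "\<not> v \<le> m" for v
    using that by (intro bexI[of _ "v-m"]) auto
  have "{e \<in> E. v \<in> e} = {if v \<le> m then {v,m+v} else {v-m,v}}" if "v \<in> {1..2*m}" for v
    using that aux by (auto simp: E_def image_iff)
  then have om: "ordered_matching M" using og by (auto simp: ordered_matching_def M_def)
  have "interval_chromatic_number M = 2" unfolding interval_chromatic_number_def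
  proof (rule Least_equality)
    have "partition_on (verts M) {{1..m},{m+1..2*m}}" using m
      by (auto simp: partition_on_def M_def disjoint_def)
    moreover have "{1..m} \<noteq> {m+1..2*m}" using m by (metis atLeastAtMost_iff One_nat_def Suc_leI le_refl not_less_eq_eq add.commute plus_1_eq_Suc)
    ultimately show "\<exists>P. partition_on (verts M) P \<and> finite P \<and> card P = 2
        \<and> (\<forall>I\<in>P. interval_of (verts M) I \<and> (\<forall>e\<in>edges M. \<not> e \<subseteq> I))" using m
      by (intro exI[of _ "{{1..m},{m+1..2*m}}"]) (auto simp: interval_of_def M_def E_def)
  next
    fix k assume "\<exists>P. partition_on (verts M) P \<and> finite P \<and> card P = k
        \<and> (\<forall>I\<in>P. interval_of (verts M) I \<and> (\<forall>e\<in>edges M. \<not> e \<subseteq> I))"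
    then obtain P where P: "partition_on (verts M) P" "finite P" "card P = k" "\<forall>I\<in>P. \<forall>e\<in>edges M. \<not> e \<subseteq> I" by blast
    have e: "{1,m+1} \<in> edges M" "{1,m+1} \<subseteq> verts M" using m by (auto simp: M_def E_def image_iff intro!: bexI[of _ 1])
    obtain A B where AB: "A \<in> P" "B \<in> P" "1 \<in> A" "m+1 \<in> B" using P(1) e(2) unfolding partition_on_def by (metis UnionE insert_subset)
    have "A \<noteq> B" using AB P(4) e(1) by auto
    then have "card {A,B} = 2" by simp
    then show "2 \<le> k" using AB P card_mono[of P "{A,B}"] by simp
  qed
  then have "M \<in> matchings2 (2*m)" using om by (simp add: matchings2_def M_def)
  then show ?thesis by auto
qed
end

theory Submission
  imports Defs
begin

text \<open>Identify \<open>M\<close> with a permutation \<open>\<sigma>\<close> of \<open>{..<m}\<close>, where \<open>n = 2 * m\<close>, and suppose that a colouring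
  of the complete graph on \<open>4 * m * t\<close> vertices has neither a red \<open>M\<close> nor a blue triangle. Blue
  neighbourhoods are red cliques, so all blue degrees are below \<open>n\<close>. Cut the right half of the
  vertices into \<open>2 * m\<close> intervals \<open>B\<^sub>j\<close> of length \<open>t\<close>; every vertex is completely blue to at most
  \<open>d \<approx> n / t\<close> of them.

  For every shift \<open>s < m\<close>, try to embed \<open>M\<close> greedily from the left half, with the right endpoint \<open>p\<close>
  mapped into \<open>B\<^bsub>p + s\<^esub>\<close>. The attempt fails, so all but \<open>m\<close> vertices \<open>v\<close> of the left half are wasted:
  \<open>v\<close> is completely blue to \<open>B\<^bsub>p + s\<^esub>\<close>, where \<open>\<sigma> p\<close> is the index waiting when \<open>v\<close> is scanned. This
  index is monotone in \<open>v\<close>. Fix \<open>2 * e\<close> typical vertices whose sets of completely blue intervals are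
  disjoint. Each of suitably chosen \<open>r\<close> shifts then gives \<open>e\<close> positions \<open>p\<close>, all distinct also
  across shifts, along which \<open>\<sigma>\<close> is increasing. A random \<open>\<sigma>\<close> increases along \<open>r\<close> given disjoint blocks
  of size \<open>e\<close> with probability \<open>(1 / e!)\<^sup>r\<close>, whereas the blocks are determined by the
  completely blue intervals and few further choices. With \<open>m \<approx> w\<^sup>8\<close>, \<open>d = w\<^sup>2\<close>, \<open>e = w\<^sup>3\<close>, \<open>r = 60 w\<^sup>2\<close>
  and \<open>t = 512 w\<^sup>6\<close> the union bound over these choices tends to \<open>0\<close>.\<close>

section \<open>Permutations increasing along disjoint blocks\<close>

text \<open>The map from \<open>(\<sigma>, \<tau>)\<close> to \<open>\<sigma> \<circ> \<tau>\<close>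
  is injective when \<open>\<sigma>\<close> is sorted along \<open>xs\<close> and
  \<open>\<tau>\<close> permutes \<open>xs\<close>: rearranging the entries keeps their set of
  values, and only one arrangement of it is sorted. Leaving \<open>Q\<close> abstract allows one
  block to be treated after another.\<close>

lemma card_sorted_block:
  fixes \<sigma> :: "'a \<Rightarrow> 'b::linorder" and Q :: "('a \<Rightarrow> 'b) set"
  assumes "finite Q" "distinct xs"
    and inj: "\<And>\<sigma>. \<sigma> \<in> Q \<Longrightarrow> inj \<sigma>"
    and closed: "\<And>\<sigma> \<tau>. \<sigma> \<in> Q \<Longrightarrow> \<tau> permutes set xs \<Longrightarrow> \<sigma> \<circ> \<tau> \<in> Q"
  shows "card {\<sigma> \<in> Q. sorted (map \<sigma> xs)} * fact (length xs) \<le> card Q"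
proof -
  let ?G = "{\<sigma> \<in> Q. sorted (map \<sigma> xs)}" and ?P = "{\<tau>. \<tau> permutes set xs}"
  have "inj_on (\<lambda>(\<sigma>, \<tau>). \<sigma> \<circ> \<tau>) (?G \<times> ?P)"
  proof (rule inj_onI, clarsimp)
    fix \<sigma> \<sigma>' \<tau> \<tau>'
    assume G: "\<sigma> \<in> Q" "\<sigma>' \<in> Q" and s: "sorted (map \<sigma> xs)" "sorted (map \<sigma>' xs)"
      and p: "\<tau> permutes set xs" "\<tau>' permutes set xs" and eq: "\<sigma> \<circ> \<tau> = \<sigma>' \<circ> \<tau>'"
    have "\<sigma> ` set xs = (\<sigma> \<circ> \<tau>) ` set xs" "\<sigma>' ` set xs = (\<sigma>' \<circ> \<tau>') ` set xs"
      using p by (simp_all only: image_comp[symmetric] permutes_image)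
    then have "set (map \<sigma> xs) = set (map \<sigma>' xs)" using eq by simp
    moreover have "distinct (map \<sigma> xs)" "distinct (map \<sigma>' xs)"
      using inj G assms(2) by (simp_all add: distinct_map inj_on_subset[OF _ subset_UNIV])
    ultimately have "map \<sigma> xs = map \<sigma>' xs" using s sorted_distinct_set_unique by blast
    then have on: "\<sigma> x = \<sigma>' x" if "x \<in> set xs" for x using that by simp
    have off: "\<sigma> x = \<sigma>' x" if "x \<notin> set xs" for x
      using fun_cong[OF eq, of x] p that by (simp add: permutes_not_in)
    have 1: "\<sigma> = \<sigma>'" using on off by blast
    then have "\<tau> = \<tau>'" using inj[OF G(1)] eq by (auto simp: fun_eq_iff inj_def)
    with 1 show "\<sigma> = \<sigma>' \<and> \<tau> = \<tau>'" by simp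
  qed
  moreover have "(\<lambda>(\<sigma>, \<tau>). \<sigma> \<circ> \<tau>) ` (?G \<times> ?P) \<subseteq> Q" using closed by auto
  ultimately have "card (?G \<times> ?P) \<le> card Q" using assms(1) card_inj_on_le by blast
  then show ?thesis
    by (simp add: card_cartesian_product card_permutations[OF refl] distinct_card[OF assms(2)])
qed

text \<open>Permuting the entries of \<open>ys\<close> leaves \<open>\<sigma>\<close> unchanged on
  the other blocks, which are disjoint from it. So sortedness along those is preserved, and each
  block contributes its own factor \<open>fact e\<close>.\<close>

lemma card_permutes_sorted_blocks:
  fixes S :: "'a::linorder set"
  assumes "finite S" "distinct (concat xss)" "set (concat xss) \<subseteq> S" "\<And>xs. xs \<in> set xss \<Longrightarrow> length xs = e"
  shows "card {\<sigma>. \<sigma> permutes S \<and> (\<forall>xs\<in>set xss. sorted (map \<sigma> xs))} * fact e ^ length xss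
         \<le> fact (card S)"
  using assms
proof (induction xss)
  case Nil
  then show ?case by (simp add: card_permutations)
next
  case (Cons ys xss)
  let ?Q = "{\<sigma>. \<sigma> permutes S \<and> (\<forall>xs\<in>set xss. sorted (map \<sigma> xs))}"
  have "card {\<sigma> \<in> ?Q. sorted (map \<sigma> ys)} * fact (length ys) \<le> card ?Q"
  proof (rule card_sorted_block)
    show "finite ?Q" using finite_permutations[OF Cons.prems(1)] by (rule rev_finite_subset) auto
    show "distinct ys" using Cons.prems by simp
    show "inj \<sigma>" if "\<sigma> \<in> ?Q" for \<sigma> using that permutes_inj by auto
    fix \<sigma> \<tau> assume \<sigma>: "\<sigma> \<in> ?Q" and \<tau>: "\<tau> permutes set ys"
    have "\<tau> permutes S" using permutes_subset[OF \<tau>] Cons.prems by simp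
    then have "\<sigma> \<circ> \<tau> permutes S" using \<sigma> by (auto intro: permutes_compose)
    moreover have "map (\<sigma> \<circ> \<tau>) xs = map \<sigma> xs" if "xs \<in> set xss" for xs
    proof -
      have "\<tau> x = x" if "x \<in> set xs" for x
        using that \<open>xs \<in> set xss\<close> Cons.prems(2) by (intro permutes_not_in[OF \<tau>]) auto
      then show ?thesis by simp
    qed
    ultimately show "\<sigma> \<circ> \<tau> \<in> ?Q" using \<sigma> by (simp del: map_eq_conv)
  qed
  moreover have "{\<sigma>. \<sigma> permutes S \<and> (\<forall>xs\<in>set (ys # xss). sorted (map \<sigma> xs))}
      = {\<sigma> \<in> ?Q. sorted (map \<sigma> ys)}" by auto
  moreover have "length ys = e" using Cons.prems by simp
  ultimately have "card {\<sigma>. \<sigma> permutes S \<and> (\<forall>xs\<in>set (ys # xss). sorted (map \<sigma> xs))} * fact e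
      \<le> card ?Q" by metis
  then have "card {\<sigma>. \<sigma> permutes S \<and> (\<forall>xs\<in>set (ys # xss). sorted (map \<sigma> xs))} * fact e * fact e ^ length xss
      \<le> card ?Q * fact e ^ length xss" by (rule mult_right_mono) simp
  also have "\<dots> \<le> fact (card S)" using Cons by simp
  finally show ?case by (simp add: mult.assoc)
qed

section \<open>Blocked greedy embeddings\<close>

text \<open>Scan \<open>0, 1, 2, \<dots>\<close> and take each vertex as the image of the next index whenever \<open>R\<close> allows it;
  \<open>g v\<close> is the index waiting to be embedded when \<open>v\<close> is scanned.\<close>

lemma greedy_embedding:
  fixes R :: "nat \<Rightarrow> nat \<Rightarrow> bool"
  obtains (embeds) f where "strict_mono_on {..<m} f" "f ` {..<m} \<subseteq> {..<L}" "\<And>i. i < m \<Longrightarrow> R (f i) i"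
  | (stuck) g where "mono g" "\<And>v. v \<le> L \<Longrightarrow> g v < m" "card {v. v < L \<and> R v (g v)} < m"
proof -
  define g where "g = rec_nat (0::nat) (\<lambda>v a. if R v a then Suc a else a)"
  have g0: "g 0 = 0" and gS: "g (Suc v) = (if R v (g v) then Suc (g v) else g v)" for v
    by (simp_all add: g_def)
  have mono: "mono g" by (rule monoI, rule lift_Suc_mono_le) (auto simp: gS)
  \<comment> \<open>Each acceptance advances the waiting index by one, so \<open>g l\<close> is also
    the number of vertices used below \<open>l\<close>; falling short of \<open>m\<close> at
    \<open>L\<close> is the \<open>stuck\<close> case.\<close>
  have cnt: "card {v. v < l \<and> R v (g v)} = g l" for l
  proof (induction l)
    case (Suc l)
    have "{v. v < Suc l \<and> R v (g v)} = (if R l (g l) then insert l else id) {v. v < l \<and> R v (g v)}"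
      by (auto simp: less_Suc_eq)
    then show ?case using Suc by (simp add: gS)
  qed (simp add: g0)
  have step: "i < g l \<Longrightarrow> \<exists>v<l. g v = i \<and> R v i" for i l
  proof (induction l)
    case (Suc l)
    then show ?case by (auto simp: gS less_Suc_eq split: if_splits)
  qed (simp add: g0)
  show thesis
  proof (cases "g L < m")
    case True
    have "g v < m" if "v \<le> L" for v using monoD[OF mono that] True by simp
    then show thesis using stuck[OF mono] cnt True by simp
  next
    case False
    then have "\<forall>i<m. \<exists>v<L. g v = i \<and> R v i" using step by simp
    then obtain f where f: "\<And>i. i < m \<Longrightarrow> f i < L \<and> g (f i) = i \<and> R (f i) i" by metis
    \<comment> \<open>\<open>f j \<le> f i\<close> would give
      \<open>j = g (f j) \<le> g (f i) = i\<close>.\<close>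
    have "strict_mono_on {..<m} f"
    proof (rule strict_mono_onI)
      fix i j assume "i \<in> {..<m}" "j \<in> {..<m}" "i < j"
      then show "f i < f j" using f[of i] f[of j] monoD[OF mono, of "f j" "f i"] by (cases "f i < f j") auto
    qed
    then show thesis using embeds f by blast
  qed
qed

section \<open>Selecting vertices and positions\<close>

lemma ex_disjoint_family:
  fixes J :: "'a \<Rightarrow> 'b set"
  assumes "finite X" "\<And>v. v \<in> X \<Longrightarrow> card {u \<in> X. u = v \<or> J u \<inter> J v \<noteq> {}} \<le> D" "q * D \<le> card X" "0 < D"
  shows "\<exists>V\<subseteq>X. card V = q \<and> disjoint_family_on J V"
  using assms
proof (induction q arbitrary: X)
  case 0
  then show ?case by (intro exI[of _ "{}"]) (simp add: disjoint_family_on_def)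
next
  case (Suc q)
  show ?case
  proof (cases "X = {}")
    case False
    then obtain v where v: "v \<in> X" by blast
    \<comment> \<open>Choosing \<open>v\<close> costs at most \<open>D\<close> candidates. The
      clause \<open>u = v\<close> removes \<open>v\<close> itself even when \<open>J v\<close> is
      empty.\<close>
    let ?C = "{u \<in> X. u = v \<or> J u \<inter> J v \<noteq> {}}"
    have "\<exists>V\<subseteq>X - ?C. card V = q \<and> disjoint_family_on J V"
    proof (rule Suc.IH)
      show "card {u' \<in> X - ?C. u' = u \<or> J u' \<inter> J u \<noteq> {}} \<le> D" if "u \<in> X - ?C" for u
      proof -
        have "card {u' \<in> X - ?C. u' = u \<or> J u' \<inter> J u \<noteq> {}} \<le> card {u' \<in> X. u' = u \<or> J u' \<inter> J u \<noteq> {}}"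
          using Suc.prems(1) by (intro card_mono) auto
        then show ?thesis using Suc.prems(2)[of u] that by simp
      qed
      have "card (X - ?C) = card X - card ?C" using Suc.prems(1) by (intro card_Diff_subset) auto
      then show "q * D \<le> card (X - ?C)" using Suc.prems(2)[OF v] Suc.prems(3) by simp
    qed (use Suc.prems(1,4) in simp_all)
    then obtain V where V: "V \<subseteq> X - ?C" "card V = q" "disjoint_family_on J V" by blast
    have "finite V" using V(1) Suc.prems(1) by (meson finite_Diff finite_subset)
    moreover have "v \<notin> V" using V v by auto
    moreover have "disjoint_family_on J (insert v V)"
      using V \<open>v \<notin> V\<close> by (auto simp: disjoint_family_on_def; blast)
    ultimately show ?thesis using V v by (intro exI[of _ "insert v V"]) auto
  next
    case True
    then show ?thesis using Suc.prems(3,4) by simp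
  qed
qed

lemma sum_card_filter_swap:
  fixes P :: "'a \<Rightarrow> 'b \<Rightarrow> bool"
  assumes "finite A" "finite B"
  shows "(\<Sum>a\<in>A. card {b \<in> B. P a b}) = (\<Sum>b\<in>B. card {a \<in> A. P a b})"
proof -
  have "(\<Sum>a\<in>A. card {b \<in> B. P a b}) = (\<Sum>a\<in>A. \<Sum>b\<in>B. if P a b then 1 else 0)"
    using assms by (simp add: sum.If_cases Int_def)
  also have "\<dots> = (\<Sum>b\<in>B. \<Sum>a\<in>A. if P a b then 1 else 0)" by (rule sum.swap)
  also have "\<dots> = (\<Sum>b\<in>B. card {a \<in> A. P a b})"
    using assms by (simp add: sum.If_cases Int_def)
  finally show ?thesis .
qed

text \<open>Row \<open>k\<close> of the table \<open>T\<close> lists the intervals that are completely blue to the \<open>k\<close>-th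
  selected vertex. A block belongs to one shift \<open>s\<close>; for each selected vertex in \<open>K\<close> it names the
  position \<open>j - s\<close>, where \<open>j\<close> is the interval in which the embedding with shift \<open>s\<close> was blocked.\<close>

definition blocks :: "nat \<Rightarrow> nat \<Rightarrow> nat \<Rightarrow> nat list list \<Rightarrow> nat list set" where
  "blocks m d e T = (\<lambda>(s, K, as). map2 (\<lambda>k a. T ! k ! a - s) (sorted_list_of_set K) as) `
     ({..<m} \<times> Pow {..<2 * e} \<times> {as. set as \<subseteq> {..<d} \<and> length as = e})"

definition has_sorted_blocks :: "nat \<Rightarrow> nat \<Rightarrow> nat \<Rightarrow> nat \<Rightarrow> (nat \<Rightarrow> nat) \<Rightarrow> bool" where
  "has_sorted_blocks m d e r \<sigma> \<longleftrightarrow>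
     (\<exists>T xss. T \<in> {T. set T \<subseteq> {l. set l \<subseteq> {..<2 * m} \<and> length l = d} \<and> length T = 2 * e}
     \<and> xss \<in> {xss. set xss \<subseteq> blocks m d e T \<and> length xss = r}
     \<and> (\<forall>xs\<in>set xss. length xs = e \<and> sorted (map \<sigma> xs))
     \<and> distinct (concat xss) \<and> set (concat xss) \<subseteq> {..<m})"

lemma finite_blocks: "finite (blocks m d e T)"
  unfolding blocks_def by (intro finite_imageI finite_cartesian_product finite_lists_length_eq) auto

text \<open>The factors are \<open>m\<close> for the shift, \<open>2 ^ (2 * e) = 4 ^ e\<close> for
  \<open>K\<close> and \<open>d ^ e\<close> for \<open>as\<close>.\<close>

lemma card_blocks: "card (blocks m d e T) \<le> m * (4 * d) ^ e"
proof -
  have "card (blocks m d e T)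
    \<le> card ({..<m} \<times> Pow {..<2 * e} \<times> {as. set as \<subseteq> {..<d} \<and> length as = e})"
    unfolding blocks_def by (intro card_image_le finite_cartesian_product finite_lists_length_eq) auto
  also have "\<dots> = m * (4 * d) ^ e"
    by (simp add: card_cartesian_product card_Pow card_lists_length_eq power_mult power_mult_distrib)
  finally show ?thesis .
qed

text \<open>Averaging over the shifts \<open>s\<close>: a fixed vertex is spoilt by few of them, being either not wasted
  or blocked at a position already in \<open>U\<close>, so some shift leaves half of the \<open>2 * e\<close> vertices usable.\<close>

lemma ex_fresh_block:
  fixes \<sigma> :: "nat \<Rightarrow> nat" and J :: "nat \<Rightarrow> nat set"
  assumes vs: "length vs = 2 * e" "sorted vs"
    and disj: "\<And>k l. k < 2 * e \<Longrightarrow> l < 2 * e \<Longrightarrow> k \<noteq> l \<Longrightarrow> J (vs ! k) \<inter> J (vs ! l) = {}"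
    and J: "\<And>k. k < 2 * e \<Longrightarrow> finite (J (vs ! k)) \<and> card (J (vs ! k)) \<le> d"
    and T: "\<And>k. k < 2 * e \<Longrightarrow> length (T ! k) = d \<and> J (vs ! k) \<subseteq> set (T ! k)"
    and mono: "\<And>s. s < m \<Longrightarrow> mono (g s)"
    and p: "\<And>s k. s < m \<Longrightarrow> k < 2 * e \<Longrightarrow> G s k \<Longrightarrow>
              p s k < m \<and> \<sigma> (p s k) = g s (vs ! k) \<and> p s k + s \<in> J (vs ! k)"
    and few: "\<And>k. k < 2 * e \<Longrightarrow> 4 * card {s \<in> {..<m}. \<not> G s k} \<le> m"
    and U: "finite U" "4 * (d * card U) \<le> m" and m: "0 < m"
  shows "\<exists>xs\<in>blocks m d e T. length xs = e \<and> distinct xs \<and> set xs \<subseteq> {..<m} - U \<and> sorted (map \<sigma> xs)"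
proof -
  define B where "B s k \<longleftrightarrow> \<not> G s k \<or> p s k \<in> U" for s k
  have B: "2 * card {s \<in> {..<m}. B s k} \<le> m" if k: "k < 2 * e" for k
  proof -
    let ?J = "J (vs ! k)" and ?D = "{s \<in> {..<m}. G s k \<and> p s k \<in> U}"
    \<comment> \<open>A shift \<open>s\<close> with \<open>p s k = u\<close> in \<open>U\<close> and
      \<open>p s k + s = j\<close> in \<open>?J\<close> equals \<open>j - u\<close>, so such shifts
      are at most as many as the pairs \<open>(j, u)\<close>.\<close>
    have "?D \<subseteq> (\<lambda>(j, u). j - u) ` (?J \<times> U)"
    proof
      fix s assume "s \<in> ?D"
      then have "(p s k + s, p s k) \<in> ?J \<times> U" using p k by auto
      then show "s \<in> (\<lambda>(j, u). j - u) ` (?J \<times> U)" by (rule rev_image_eqI) simp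
    qed
    then have "card ?D \<le> card (?J \<times> U)"
      using J[OF k] U(1) by (intro surj_card_le) auto
    also have "\<dots> \<le> d * card U" using J[OF k] by (simp add: card_cartesian_product)
    finally have "4 * card ?D \<le> m" using U(2) by linarith
    moreover have "card {s \<in> {..<m}. B s k} \<le> card ({s \<in> {..<m}. \<not> G s k} \<union> ?D)"
      by (rule card_mono) (auto simp: B_def)
    moreover have "card ({s \<in> {..<m}. \<not> G s k} \<union> ?D) \<le> card {s \<in> {..<m}. \<not> G s k} + card ?D"
      by (rule card_Un_le)
    ultimately show ?thesis using few[OF k] by linarith
  qed
  \<comment> \<open>If every shift spoilt at least \<open>e + 1\<close> selected vertices, there
    would be at least \<open>m * (e + 1)\<close> spoilt pairs; by \<open>B\<close> there are at most
    \<open>e * m\<close>.\<close>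
  obtain s where s: "s < m" "card {k \<in> {..<2 * e}. B s k} \<le> e"
  proof (rule ccontr)
    assume "\<not> thesis"
    with that have "Suc e \<le> card {k \<in> {..<2 * e}. B s k}" if "s \<in> {..<m}" for s
      using that by (meson lessThan_iff not_less_eq_eq)
    then have "m * Suc e \<le> (\<Sum>s<m. card {k \<in> {..<2 * e}. B s k})"
      using sum_bounded_below[of "{..<m}" "Suc e"] by simp
    also have "\<dots> = (\<Sum>k<2 * e. card {s \<in> {..<m}. B s k})" by (rule sum_card_filter_swap) auto
    finally have "2 * (m * Suc e) \<le> (\<Sum>k<2 * e. 2 * card {s \<in> {..<m}. B s k})"
      by (simp add: sum_distrib_left[symmetric])
    also have "\<dots> \<le> 2 * e * m" using sum_bounded_above[of "{..<2 * e}" _ m] B by simp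
    finally show False using m by simp
  qed
  let ?K = "{k \<in> {..<2 * e}. \<not> B s k}"
  have "?K = {..<2 * e} - {k \<in> {..<2 * e}. B s k}" by auto
  also have "card \<dots> = card {..<2 * e} - card {k \<in> {..<2 * e}. B s k}"
    by (rule card_Diff_subset) auto
  finally have "e \<le> card ?K" using s(2) by simp
  then obtain K where K: "K \<subseteq> ?K" "card K = e" "finite K" by (rule obtain_subset_with_card_n)
  define ks where "ks = sorted_list_of_set K"
  have ks: "set ks = K" "sorted ks" "distinct ks" "length ks = e" using K by (simp_all add: ks_def)
  have pK: "p s k < m" "\<sigma> (p s k) = g s (vs ! k)" "p s k + s \<in> J (vs ! k)" "p s k \<notin> U" "k < 2 * e"
    if "k \<in> K" for k using that K(1) p[OF s(1)] by (auto simp: B_def)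
  have "\<exists>a<d. T ! k ! a = p s k + s" if "k \<in> K" for k
    using pK(3)[OF that] T[OF pK(5)[OF that]] by (metis in_set_conv_nth subsetD)
  then obtain h where h: "\<And>k. k \<in> K \<Longrightarrow> h k < d \<and> T ! k ! h k = p s k + s" by metis
  \<comment> \<open>The subtraction in \<open>blocks\<close> is exact here, since the named entry is
    \<open>p s k + s\<close>.\<close>
  have eq: "map (p s) ks = map2 (\<lambda>k a. T ! k ! a - s) ks (map h ks)"
    using h ks(1) by (simp add: zip_map2 zip_same_conv_map)
  have "(s, K, map h ks) \<in> {..<m} \<times> Pow {..<2 * e} \<times> {as. set as \<subseteq> {..<d} \<and> length as = e}"
    using s(1) K ks h by auto
  then have 1: "map (p s) ks \<in> blocks m d e T"
    unfolding blocks_def by (rule rev_image_eqI) (simp add: eq ks_def[symmetric])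
  \<comment> \<open>Equal positions would put the same interval \<open>p s k + s\<close> into two
    disjoint sets \<open>J\<close>.\<close>
  have "inj_on (p s) K"
    using disj pK(3,5) by (intro inj_onI) (metis disjoint_iff)
  then have 2: "distinct (map (p s) ks)" using ks by (simp add: distinct_map)
  have 3: "set (map (p s) ks) \<subseteq> {..<m} - U" using pK ks by auto
  \<comment> \<open>Both \<open>ks\<close> and \<open>vs\<close> are sorted and the waiting index is
    monotone in the vertex, so the values of \<open>\<sigma>\<close> are sorted along the chosen
    positions.\<close>
  have "sorted (map (\<lambda>k. g s (vs ! k)) ks)"
    unfolding sorted_map
  proof (rule sorted_wrt_mono_rel[OF _ ks(2)])
    fix k l assume "k \<in> set ks" "l \<in> set ks" "k \<le> l"
    then have "vs ! k \<le> vs ! l" using vs ks(1) pK(5) by (simp add: sorted_nth_mono)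
    then show "g s (vs ! k) \<le> g s (vs ! l)" by (rule monoD[OF mono[OF s(1)]])
  qed
  moreover have "map \<sigma> (map (p s) ks) = map (\<lambda>k. g s (vs ! k)) ks" using pK(2) ks(1) by simp
  ultimately show ?thesis using 1 2 3 ks(4) by (metis length_map)
qed

text \<open>Separates the combinatorics from colourings: \<open>J v\<close> stands for the intervals
  completely blue to \<open>v\<close>, and \<open>W s v\<close> for \<open>v\<close> being wasted
  under shift \<open>s\<close>. All but \<open>4 * m\<close> vertices are wasted under at least
  three quarters of the shifts; \<open>2 * e\<close> of these with disjoint \<open>J\<close> feed
  \<open>ex_fresh_block\<close>, which is applied \<open>r\<close> times.\<close>

lemma has_sorted_blocksI:
  fixes \<sigma> :: "nat \<Rightarrow> nat" and J :: "nat \<Rightarrow> nat set"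
  assumes J: "\<And>v. v < L \<Longrightarrow> J v \<subseteq> {..<2 * m} \<and> card (J v) \<le> d"
    and deg: "\<And>j. card {v. v < L \<and> j \<in> J v} \<le> 2 * m"
    and mono: "\<And>s. s < m \<Longrightarrow> mono (g s)"
    and few: "\<And>s. s < m \<Longrightarrow> card {v \<in> {..<L}. \<not> W s v} \<le> m"
    and W: "\<And>s v. s < m \<Longrightarrow> v < L \<Longrightarrow> W s v \<Longrightarrow> \<exists>p<m. \<sigma> p = g s v \<and> p + s \<in> J v"
    and L: "2 * e * (2 * m * d + 1) + 4 * m \<le> L" and r: "4 * d * e * r \<le> m" and m: "0 < m"
  shows "has_sorted_blocks m d e r \<sigma>"
proof -
  define X where "X = {v \<in> {..<L}. 4 * card {s \<in> {..<m}. \<not> W s v} \<le> m}"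
  let ?Y = "{v \<in> {..<L}. \<not> 4 * card {s \<in> {..<m}. \<not> W s v} \<le> m}"
  \<comment> \<open>Markov's inequality: for a vertex in \<open>?Y\<close> more than
    \<open>m / 4\<close> shifts fail to waste it, hence the weight \<open>Suc m\<close>, while there
    are at most \<open>m * m\<close> unwasted pairs in all.\<close>
  have "card ?Y * Suc m \<le> (\<Sum>v\<in>?Y. 4 * card {s \<in> {..<m}. \<not> W s v})"
    using sum_bounded_below[of ?Y "Suc m" "\<lambda>v. 4 * card {s \<in> {..<m}. \<not> W s v}"] by simp
  also have "\<dots> \<le> (\<Sum>v<L. 4 * card {s \<in> {..<m}. \<not> W s v})" by (rule sum_mono2) auto
  also have "\<dots> = 4 * (\<Sum>v<L. card {s \<in> {..<m}. \<not> W s v})" by (simp add: sum_distrib_left)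
  also have "(\<Sum>v<L. card {s \<in> {..<m}. \<not> W s v}) = (\<Sum>s<m. card {v \<in> {..<L}. \<not> W s v})"
    by (rule sum_card_filter_swap) auto
  also have "\<dots> \<le> m * m" using sum_bounded_above[of "{..<m}" _ m] few by simp
  finally have "card ?Y * Suc m \<le> 4 * m * Suc m" by simp
  then have "card ?Y \<le> 4 * m" by (simp only: mult_le_cancel2)
  moreover have "X = {..<L} - ?Y" by (auto simp: X_def)
  moreover have "card ({..<L} - ?Y) = card {..<L} - card ?Y" by (rule card_Diff_subset) auto
  ultimately have cX: "2 * e * (2 * m * d + 1) \<le> card X" using L by simp
  have "\<exists>V\<subseteq>X. card V = 2 * e \<and> disjoint_family_on J V"
  proof (rule ex_disjoint_family[OF _ _ cX])
    fix v assume v: "v \<in> X"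
    have Jv: "finite (J v)" "card (J v) \<le> d"
      using J[of v] v by (auto simp: X_def intro: finite_subset)
    \<comment> \<open>Besides \<open>v\<close> itself, a vertex in conflict with \<open>v\<close>
      shares one of at most \<open>d\<close> intervals with it, each belonging to at most
      \<open>2 * m\<close> vertices.\<close>
    have "card {u \<in> X. u = v \<or> J u \<inter> J v \<noteq> {}} \<le> card (insert v (\<Union>j\<in>J v. {u. u < L \<and> j \<in> J u}))"
      using Jv by (intro card_mono) (auto simp: X_def)
    also have "\<dots> \<le> Suc (card (\<Union>j\<in>J v. {u. u < L \<and> j \<in> J u}))" using Jv by (simp add: card_insert_if)
    also have "card (\<Union>j\<in>J v. {u. u < L \<and> j \<in> J u}) \<le> (\<Sum>j\<in>J v. card {u. u < L \<and> j \<in> J u})"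
      by (rule card_UN_le) fact
    also have "\<dots> \<le> card (J v) * (2 * m)" using sum_bounded_above[of "J v" _ "2 * m"] deg by simp
    also have "\<dots> \<le> d * (2 * m)" using Jv by simp
    finally show "card {u \<in> X. u = v \<or> J u \<inter> J v \<noteq> {}} \<le> 2 * m * d + 1" by (simp add: mult_ac)
  qed (auto simp: X_def)
  then obtain V where V: "V \<subseteq> X" "card V = 2 * e" "disjoint_family_on J V" by blast
  have fV: "finite V" using V(1) by (rule finite_subset) (simp add: X_def)
  define vs where "vs = sorted_list_of_set V"
  have vs: "length vs = 2 * e" "sorted vs" "distinct vs" "set vs = V"
    using V fV by (simp_all add: vs_def)
  have vsV: "vs ! k \<in> V" "vs ! k < L" "vs ! k \<in> X" if "k < 2 * e" for k
    using that vs V(1) nth_mem[of k vs] by (auto simp: X_def)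
  \<comment> \<open>Padding gives all rows length \<open>d\<close>, so that tables are counted as
    lists of fixed length; the entry \<open>0\<close> is legal because \<open>0 < m\<close>.\<close>
  define T where "T = map (\<lambda>v. sorted_list_of_set (J v) @ replicate (d - card (J v)) 0) vs"
  have finJ: "finite (J v)" if "v < L" for v using J[OF that] finite_subset by blast
  have T1: "length (T ! k) = d \<and> J (vs ! k) \<subseteq> set (T ! k)" if "k < 2 * e" for k
    using J[OF vsV(2)[OF that]] finJ[OF vsV(2)[OF that]] vs that by (simp add: T_def)
  have T2: "length T = 2 * e" using vs by (simp add: T_def)
  have T3: "set T \<subseteq> {l. set l \<subseteq> {..<2 * m} \<and> length l = d}"
  proof
    fix l assume "l \<in> set T"
    then obtain v where v: "v \<in> V" "l = sorted_list_of_set (J v) @ replicate (d - card (J v)) 0"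
      using vs(4) by (auto simp: T_def)
    have "v < L" using v(1) V(1) by (auto simp: X_def)
    from J[OF this] finJ[OF this] m show "l \<in> {l. set l \<subseteq> {..<2 * m} \<and> length l = d}"
      by (auto simp: v(2) subset_eq)
  qed
  have "\<forall>s v. \<exists>p. s < m \<longrightarrow> v < L \<longrightarrow> W s v \<longrightarrow> p < m \<and> \<sigma> p = g s v \<and> p + s \<in> J v" using W by blast
  then obtain p where p: "\<And>s v. s < m \<Longrightarrow> v < L \<Longrightarrow> W s v \<Longrightarrow> p s v < m \<and> \<sigma> (p s v) = g s v \<and> p s v + s \<in> J v"
    by metis
  \<comment> \<open>Blocks are added one by one, avoiding the set \<open>?U\<close> of positions
    already used. Keeping \<open>l \<le> r\<close> bounds its size by \<open>e * r\<close>, as the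
    averaging requires.\<close>
  have "\<exists>xss. xss \<in> {xss. set xss \<subseteq> blocks m d e T \<and> length xss = l}
     \<and> (\<forall>xs\<in>set xss. length xs = e \<and> sorted (map \<sigma> xs))
     \<and> distinct (concat xss) \<and> set (concat xss) \<subseteq> {..<m}" if "l \<le> r" for l
    using that
  proof (induction l)
    case 0
    then show ?case by (intro exI[of _ "[]"]) simp
  next
    case (Suc l)
    then obtain xss where xss: "set xss \<subseteq> blocks m d e T" "length xss = l"
      "\<forall>xs\<in>set xss. length xs = e \<and> sorted (map \<sigma> xs)" "distinct (concat xss)" "set (concat xss) \<subseteq> {..<m}"
      by auto
    let ?U = "set (concat xss)"
    have "\<exists>xs\<in>blocks m d e T. length xs = e \<and> distinct xs \<and> set xs \<subseteq> {..<m} - ?U \<and> sorted (map \<sigma> xs)"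
    proof (rule ex_fresh_block[where J = J and vs = vs and p = "\<lambda>s k. p s (vs ! k)" and g = g
          and G = "\<lambda>s k. W s (vs ! k)"])
      show "J (vs ! k) \<inter> J (vs ! l) = {}" if "k < 2 * e" "l < 2 * e" "k \<noteq> l" for k l
        using V(3) vsV that vs nth_eq_iff_index_eq[OF vs(3)] by (auto simp: disjoint_family_on_def)
      show "4 * card {s \<in> {..<m}. \<not> W s (vs ! k)} \<le> m" if "k < 2 * e" for k
        using vsV(3)[OF that] by (simp add: X_def)
      have "card ?U \<le> length (concat xss)" by (rule card_length)
      also have "\<dots> = e * l" using xss(2,3)
        by (simp add: length_concat sum_list_triv cong: map_cong)
      also have "\<dots> \<le> e * r" using Suc.prems by simp
      finally have "4 * (d * card ?U) \<le> 4 * (d * (e * r))" by (intro mult_le_mono order_refl)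
      also have "\<dots> \<le> m" using r by (simp add: mult.assoc)
      finally show "4 * (d * card ?U) \<le> m" .
    qed (use vs vsV finJ J T1 mono p m in auto)
    then obtain xs where "xs \<in> blocks m d e T" "length xs = e" "distinct xs" "set xs \<subseteq> {..<m} - ?U"
      "sorted (map \<sigma> xs)" by blast
    then show ?case using xss by (intro exI[of _ "xs # xss"]) auto
  qed
  then show ?thesis unfolding has_sorted_blocks_def using T2 T3 by blast
qed

section \<open>Colourings avoiding a matching and a triangle\<close>

lemma mono_copyI:
  assumes G: "ordered_graph G" and f: "strict_mono_on (verts G) f" "f ` verts G \<subseteq> {1..N}"
    and col: "\<And>e. e \<in> edges G \<Longrightarrow> col (f ` e) = c"
  shows "mono_copy col c G N"
proof -
  let ?H = "(f ` verts G, (`) f ` edges G)"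
  have inj: "inj_on f (verts G)" using f(1) by (rule strict_mono_on_imp_inj_on)
  have "edges ?H \<subseteq> nsets (verts ?H) 2"
    using G card_image[OF inj_on_subset[OF inj]] by (auto simp: ordered_graph_def nsets_def)
  moreover have "nsets (verts ?H) 2 \<subseteq> nsets {1..N} 2" using f(2) by (simp add: nsets_mono)
  ultimately have "ordered_subgraph ?H (complete_ograph N)"
    using G f(2) by (auto simp: ordered_subgraph_def ordered_graph_def complete_ograph_def)
  moreover have "ordered_iso G ?H"
    unfolding ordered_iso_def using f inj by (intro exI[of _ f]) (simp add: bij_betw_def)
  ultimately show ?thesis unfolding mono_copy_def using col by (intro exI[of _ ?H]) auto
qed

lemma blue_triangle:
  assumes "\<not> mono_copy col Blue (complete_ograph 3) N"
    and "x \<in> {1..N}" "y \<in> {1..N}" "z \<in> {1..N}" "x \<noteq> y" "y \<noteq> z" "x \<noteq> z"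
  shows "\<not> (col {x, y} = Blue \<and> col {y, z} = Blue \<and> col {x, z} = Blue)"
proof -
  have ord: "\<not> (col {x, y} = Blue \<and> col {y, z} = Blue \<and> col {x, z} = Blue)"
    if "x \<in> {1..N}" "z \<in> {1..N}" "x < y" "y < z" for x y z
  proof
    assume c: "col {x, y} = Blue \<and> col {y, z} = Blue \<and> col {x, z} = Blue"
    let ?f = "\<lambda>i::nat. if i = 1 then x else if i = 2 then y else z"
    have "mono_copy col Blue (complete_ograph 3) N"
    proof (rule mono_copyI[where f = ?f])
      show "strict_mono_on (verts (complete_ograph 3)) ?f"
        using that by (auto simp: complete_ograph_def strict_mono_on_def)
      show "?f ` verts (complete_ograph 3) \<subseteq> {1..N}"
        using that by (auto simp: complete_ograph_def)
      fix e assume "e \<in> edges (complete_ograph 3)"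
      then obtain i j where ij: "e = {i, j}" "1 \<le> i" "i < j" "j \<le> 3"
        by (auto simp: complete_ograph_def ordered_nsets_2_eq)
      then have "(i = 1 \<and> j = 2) \<or> (i = 2 \<and> j = 3) \<or> (i = 1 \<and> j = 3)" by auto
      then show "col (?f ` e) = Blue" using ij(1) c by (auto simp: insert_commute)
    qed (simp add: complete_ograph_def ordered_graph_def)
    then show False using assms(1) by simp
  qed
  show ?thesis
    using assms(2-) ord[of x y z] ord[of x z y] ord[of y x z] ord[of y z x] ord[of z x y] ord[of z y x]
    by (auto simp: insert_commute neq_iff)
qed

text \<open>Two blue neighbours of \<open>v\<close> are joined in red, as there is no blue triangle.
  Hence \<open>n\<close> of them would span a red clique, which contains every ordered graph on
  \<open>n\<close> vertices.\<close>

lemma card_blue_nbhd: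
  assumes tri: "\<not> mono_copy col Blue (complete_ograph 3) N"
    and G: "ordered_graph G" "verts G = {1..n}" "\<not> mono_copy col Red G N" and v: "v \<in> {1..N}"
  shows "card {u \<in> {1..N}. u \<noteq> v \<and> col {u, v} = Blue} < n"
proof (rule ccontr)
  assume "\<not> ?thesis"
  then obtain S where S: "S \<subseteq> {u \<in> {1..N}. u \<noteq> v \<and> col {u, v} = Blue}" "card S = n" "finite S"
    by (meson not_less obtain_subset_with_card_n)
  obtain h where h: "bij_betw h {..<n} S" "strict_mono_on {..<n} h"
    using ex_bij_betw_strict_mono_card[OF S(3)] S(2) by metis
  define f where "f x = h (x - 1)" for x
  have fS: "f x \<in> S" if "x \<in> {1..n}" for x
    using that bij_betw_apply[OF h(1), of "x - 1"] by (auto simp: f_def)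
  have mono: "strict_mono_on {1..n} f"
    using strict_mono_onD[OF h(2)] by (intro strict_mono_onI) (auto simp: f_def)
  have "mono_copy col Red G N"
  proof (rule mono_copyI[OF G(1)])
    show "strict_mono_on (verts G) f" using mono G(2) by simp
    show "f ` verts G \<subseteq> {1..N}" using fS S(1) unfolding G(2) by blast
    fix e assume "e \<in> edges G"
    then have "e \<in> nsets {1..n} 2" using G by (auto simp: ordered_graph_def)
    then obtain x y where e: "e = {x, y}" "x \<in> {1..n}" "y \<in> {1..n}" "x < y"
      by (auto simp: ordered_nsets_2_eq)
    have "f x \<noteq> f y" using strict_mono_onD[OF mono e(2-4)] by simp
    moreover have "f x \<in> {1..N}" "f x \<noteq> v" "col {f x, v} = Blue" "f y \<in> {1..N}" "f y \<noteq> v" "col {f y, v} = Blue"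
      using fS[OF e(2)] fS[OF e(3)] S(1) by auto
    ultimately have "col {f x, f y} \<noteq> Blue" using blue_triangle[OF tri, of "f x" "f y" v] v by auto
    then show "col (f ` e) = Red" using e(1) by (cases "col {f x, f y}") auto
  qed
  then show False using G(3) by simp
qed

text \<open>The permutation goes from right endpoints to left ones: blocks consist of right
  endpoints \<open>p\<close>, and the greedy scan embeds the left endpoints
  \<open>\<sigma> p\<close> in increasing order. Indices start at 0, hence the
  \<open>Suc\<close>.\<close>

definition perm_matching :: "nat \<Rightarrow> (nat \<Rightarrow> nat) \<Rightarrow> nat ograph" where
  "perm_matching m \<sigma> = ({1..2 * m}, (\<lambda>p. {Suc (\<sigma> p), Suc (m + p)}) ` {..<m})"

lemma ordered_graph_perm_matching:
  assumes "\<sigma> permutes {..<m}"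
  shows "ordered_graph (perm_matching m \<sigma>)"
proof -
  have "\<sigma> p < m" if "p < m" for p using permutes_in_image[OF assms, of p] that by simp
  then show ?thesis by (fastforce simp: ordered_graph_def perm_matching_def nsets_def card_2_iff')
qed

text \<open>A successful scan for any shift would give a red copy of the matching, so every scan is
  stuck, and a vertex rejected while \<open>\<sigma> p\<close> waits has only blue edges to
  \<open>B (p + s)\<close>. Positions and shifts are below \<open>m\<close>, so \<open>2 * m\<close>
  intervals suffice.\<close>

lemma has_sorted_blocks_if_avoiding:
  assumes \<sigma>: "\<sigma> permutes {..<m}" and m: "0 < m" and t: "2 * m \<le> (d + 1) * t"
    and L: "2 * e * (2 * m * d + 1) + 4 * m \<le> 2 * m * t" and r: "4 * d * e * r \<le> m"
    and red: "\<not> mono_copy col Red (perm_matching m \<sigma>) (4 * m * t)"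
    and blue: "\<not> mono_copy col Blue (complete_ograph 3) (4 * m * t)"
  shows "has_sorted_blocks m d e r \<sigma>"
proof -
  \<comment> \<open>Vertices are counted from 0 and passed to \<open>col\<close> through
    \<open>Suc\<close>; those below \<open>L\<close> form the left half, and the intervals
    \<open>B j\<close> with \<open>j < 2 * m\<close> tile the right half.\<close>
  define L where "L = 2 * m * t"
  define N where "N = 4 * m * t"
  have LN: "N = 2 * L" by (simp add: L_def N_def)
  have t0: "0 < t" using m t by (cases t) auto
  have col: "c \<noteq> Blue \<longleftrightarrow> c = Red" for c by (cases c) auto
  have deg: "card {u \<in> {1..N}. u \<noteq> v \<and> col {u, v} = Blue} < 2 * m" if "v \<in> {1..N}" for v
    using card_blue_nbhd[OF blue ordered_graph_perm_matching[OF \<sigma>] _ red, of "2 * m" v] that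
    by (simp add: perm_matching_def N_def)
  define B where "B j = {L + j * t..<L + Suc j * t}" for j
  have BN: "Suc y \<in> {1..N}" "L \<le> y" if "y \<in> B j" "j < 2 * m" for y j
  proof -
    have "Suc j * t \<le> 2 * m * t" using that(2) by (intro mult_right_mono) auto
    then show "Suc y \<in> {1..N}" "L \<le> y" using that(1) LN unfolding B_def L_def[symmetric] by auto
  qed
  have Bless: "y < y'" if "y \<in> B j" "y' \<in> B j'" "j < j'" for y y' j j'
  proof -
    have "Suc j * t \<le> j' * t" using that(3) by (intro mult_right_mono) auto
    then show ?thesis using that(1,2) unfolding B_def by auto
  qed
  define J where "J v = {j \<in> {..<2 * m}. \<forall>y\<in>B j. col {Suc v, Suc y} = Blue}" for v
  have cardJ: "card (J v) \<le> d" if v: "v < L" for v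
  proof -
    \<comment> \<open>The \<open>card (J v) * t\<close> vertices in these intervals are all blue
      neighbours of \<open>v\<close>, whose blue degree is below
      \<open>2 * m \<le> (d + 1) * t\<close>.\<close>
    let ?h = "\<lambda>(j, i). Suc (L + (j * t + i))"
    have "inj_on ?h (J v \<times> {..<t})"
    proof (rule inj_onI, clarsimp)
      fix j i j' i' assume *: "i < t" "i' < t" "j * t + i = j' * t + i'"
      have "(j * t + i) div t = j" "(j' * t + i') div t = j'" using *(1,2) by simp_all
      then have "j = j'" using *(3) by metis
      then show "j = j' \<and> i = i'" using * by simp
    qed
    moreover have "?h ` (J v \<times> {..<t}) \<subseteq> {u \<in> {1..N}. u \<noteq> Suc v \<and> col {u, Suc v} = Blue}"
    proof
      fix u assume "u \<in> ?h ` (J v \<times> {..<t})"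
      then obtain j i where ji: "j \<in> J v" "i < t" and u: "u = Suc (L + (j * t + i))" by auto
      have "L + (j * t + i) \<in> B j" using ji by (auto simp: B_def)
      then show "u \<in> {u \<in> {1..N}. u \<noteq> Suc v \<and> col {u, Suc v} = Blue}"
        using ji(1) BN[of "L + (j * t + i)" j] v by (auto simp: J_def u insert_commute)
    qed
    ultimately have "card (J v \<times> {..<t}) \<le> card {u \<in> {1..N}. u \<noteq> Suc v \<and> col {u, Suc v} = Blue}"
      by (rule card_inj_on_le) simp
    also have "\<dots> < 2 * m" using v LN by (intro deg) auto
    finally have "card (J v) * t < (d + 1) * t" using t by (simp add: card_cartesian_product)
    then have "card (J v) < d + 1" by (simp only: mult_less_cancel2)
    then show ?thesis by simp
  qed
  have degJ: "card {v. v < L \<and> j \<in> J v} \<le> 2 * m" for j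
  proof (cases "j < 2 * m")
    case True
    \<comment> \<open>Every \<open>v\<close> counted here is a blue neighbour of the first vertex of
      \<open>B j\<close>, so the blue degree of that single vertex gives the bound.\<close>
    have y: "L + j * t \<in> B j" using t0 by (simp add: B_def)
    have "card {v. v < L \<and> j \<in> J v} = card (Suc ` {v. v < L \<and> j \<in> J v})" by (simp add: card_image)
    also have "\<dots> \<le> card {u \<in> {1..N}. u \<noteq> Suc (L + j * t) \<and> col {u, Suc (L + j * t)} = Blue}"
      using y LN by (intro card_mono) (auto simp: J_def)
    also have "\<dots> < 2 * m" using BN[OF y True] by (intro deg) auto
    finally show ?thesis by simp
  qed (simp add: J_def)
  define stuck where "stuck s g \<longleftrightarrow> mono g \<and>
      card {v. v < L \<and> (\<exists>y\<in>B (inv \<sigma> (g v) + s). col {Suc v, Suc y} = Red)} < m \<and> (\<forall>v\<le>L. g v < m)" for s g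
  have "\<exists>g. stuck s g" if s: "s < m" for s
  proof (rule greedy_embedding[of m L "\<lambda>v i. \<exists>y\<in>B (inv \<sigma> i + s). col {Suc v, Suc y} = Red"])
    fix f assume f: "strict_mono_on {..<m} f" "f ` {..<m} \<subseteq> {..<L}"
      and R: "\<And>i. i < m \<Longrightarrow> \<exists>y\<in>B (inv \<sigma> i + s). col {Suc (f i), Suc y} = Red"
    have "\<exists>y\<in>B (p + s). col {Suc (f (\<sigma> p)), Suc y} = Red" if "p < m" for p
      using R[of "\<sigma> p"] permutes_in_image[OF \<sigma>, of p] that by (simp add: permutes_inverses[OF \<sigma>])
    then obtain Y where Y: "\<And>p. p < m \<Longrightarrow> Y p \<in> B (p + s) \<and> col {Suc (f (\<sigma> p)), Suc (Y p)} = Red"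
      by metis
    have YN: "Suc (Y p) \<in> {1..N}" "L \<le> Y p" if "p < m" for p
      using BN[of "Y p" "p + s"] Y[OF that] s that by auto
    have Ymono: "Y p < Y p'" if "p < p'" "p' < m" for p p'
      using Bless[of "Y p" "p + s" "Y p'" "p' + s"] Y that by simp
    \<comment> \<open>\<open>f\<close> places the left endpoints and \<open>Y\<close> the right
      ones; \<open>x - 1\<close> and \<open>x - 1 - m\<close> turn vertices of the matching into
      indices starting at 0.\<close>
    define F where "F x = (if x \<le> m then Suc (f (x - 1)) else Suc (Y (x - 1 - m)))" for x
    have fL: "f i < L" if "i < m" for i using f(2) that by auto
    have "mono_copy col Red (perm_matching m \<sigma>) N"
    proof (rule mono_copyI[OF ordered_graph_perm_matching[OF \<sigma>]])
      show "strict_mono_on (verts (perm_matching m \<sigma>)) F"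
      proof (rule strict_mono_onI)
        fix a b assume ab: "a \<in> verts (perm_matching m \<sigma>)" "b \<in> verts (perm_matching m \<sigma>)" "a < b"
        then have r: "1 \<le> a" "b \<le> 2 * m" by (auto simp: perm_matching_def)
        consider "b \<le> m" | "a \<le> m" "m < b" | "m < a" by linarith
        then show "F a < F b"
        proof cases
          case 1
          then show ?thesis using strict_mono_onD[OF f(1), of "a - 1" "b - 1"] r ab(3) by (simp add: F_def)
        next
          case 2
          then have "f (a - 1) < L" "L \<le> Y (b - 1 - m)" using r by (auto intro!: fL YN(2))
          then show ?thesis using 2 by (simp add: F_def)
        next
          case 3
          then show ?thesis using Ymono[of "a - 1 - m" "b - 1 - m"] r ab(3) by (simp add: F_def)
        qed
      qed
      show "F ` verts (perm_matching m \<sigma>) \<subseteq> {1..N}"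
      proof clarify
        fix a assume "a \<in> verts (perm_matching m \<sigma>)"
        then have r: "1 \<le> a" "a \<le> 2 * m" by (auto simp: perm_matching_def)
        show "F a \<in> {1..N}"
        proof (cases "a \<le> m")
          case True
          then have "f (a - 1) < L" using r by (intro fL) auto
          then show ?thesis using True LN by (simp add: F_def)
        next
          case False
          then have "Suc (Y (a - 1 - m)) \<in> {1..N}" using r by (intro YN) auto
          then show ?thesis using False by (simp add: F_def)
        qed
      qed
      fix e assume "e \<in> edges (perm_matching m \<sigma>)"
      then obtain p where p: "p < m" "e = {Suc (\<sigma> p), Suc (m + p)}" by (auto simp: perm_matching_def)
      have "\<sigma> p < m" using permutes_in_image[OF \<sigma>, of p] p(1) by simp
      then have "F (Suc (\<sigma> p)) = Suc (f (\<sigma> p))" "F (Suc (m + p)) = Suc (Y p)"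
        by (simp_all add: F_def)
      then show "col (F ` e) = Red" using Y[OF p(1)] by (simp only: p(2) image_insert image_empty)
    qed
    then show ?thesis using red by (simp add: N_def)
  qed (unfold stuck_def, blast)
  then obtain g where "\<And>s. s < m \<Longrightarrow> stuck s (g s)" by metis
  note g = this[unfolded stuck_def]
  show ?thesis
  proof (rule has_sorted_blocksI[where J = J and L = L and g = g and
        W = "\<lambda>s v. \<not> (\<exists>y\<in>B (inv \<sigma> (g s v) + s). col {Suc v, Suc y} = Red)"])
    show "card {v \<in> {..<L}. \<not> \<not> (\<exists>y\<in>B (inv \<sigma> (g s v) + s). col {Suc v, Suc y} = Red)} \<le> m"
      if "s < m" for s using g[OF that] by simp
    fix s v
    assume sv: "s < m" "v < L" "\<not> (\<exists>y\<in>B (inv \<sigma> (g s v) + s). col {Suc v, Suc y} = Red)"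
    let ?p = "inv \<sigma> (g s v)"
    have "g s v < m" using g[OF sv(1)] sv(2) by simp
    then have "?p < m" using permutes_in_image[OF permutes_inv[OF \<sigma>]] by simp
    moreover have "\<sigma> ?p = g s v" by (rule permutes_inverses[OF \<sigma>])
    moreover have "?p + s \<in> J v" using sv \<open>?p < m\<close> col by (auto simp: J_def)
    ultimately show "\<exists>p<m. \<sigma> p = g s v \<and> p + s \<in> J v" by blast
  qed (use L r m g cardJ degJ in \<open>auto simp: J_def L_def\<close>)
qed

section \<open>Matchings of interval chromatic number two\<close>

lemma perm_matching_in_matchings2:
  assumes \<sigma>: "\<sigma> permutes {..<m}" and m: "0 < m"
  shows "perm_matching m \<sigma> \<in> matchings2 (2 * m)"
proof -
  let ?M = "perm_matching m \<sigma>"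
  have verts: "verts ?M = {1..2 * m}" by (simp add: perm_matching_def)
  have lt: "\<sigma> p < m \<longleftrightarrow> p < m" for p using permutes_in_image[OF \<sigma>, of p] by simp
  have deg: "card {e \<in> edges ?M. v \<in> e} = 1" if v: "v \<in> verts ?M" for v
  proof -
    obtain p where p: "p < m" "\<And>q. q < m \<Longrightarrow> v \<in> {Suc (\<sigma> q), Suc (m + q)} \<longleftrightarrow> q = p"
    proof (cases "v \<le> m")
      case True
      have "\<sigma> (inv \<sigma> (v - 1)) = v - 1" by (rule permutes_inverses[OF \<sigma>])
      moreover have "v - 1 < m" "1 \<le> v" using True v by (auto simp: perm_matching_def)
      ultimately show thesis
        using that[of "inv \<sigma> (v - 1)"] lt[of "inv \<sigma> (v - 1)"] True permutes_inverses(2)[OF \<sigma>] by force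
    next
      case False
      then have "v - Suc m < m" "v = Suc (m + (v - Suc m))" using v by (auto simp: perm_matching_def)
      moreover have "Suc (\<sigma> q) \<noteq> v" if "q < m" for q using lt[of q] that False by simp
      ultimately show thesis using that[of "v - Suc m"] by force
    qed
    then have "{e \<in> edges ?M. v \<in> e} = {{Suc (\<sigma> p), Suc (m + p)}}"
      unfolding perm_matching_def snd_conv by blast
    then show ?thesis by simp
  qed
  have om: "ordered_matching ?M"
    using deg ordered_graph_perm_matching[OF \<sigma>] by (simp add: ordered_matching_def)
  have "interval_chromatic_number ?M = 2" unfolding interval_chromatic_number_def
  proof (rule Least_equality)
    have ne: "{1..m} \<noteq> {m + 1..2 * m}" using m by (auto simp: set_eq_iff intro!: exI[of _ 1])
    have "partition_on (verts ?M) {{1..m}, {m + 1..2 * m}}" using m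
      by (auto simp: partition_on_def perm_matching_def disjoint_def)
    moreover have "\<not> e \<subseteq> {1..m} \<and> \<not> e \<subseteq> {m + 1..2 * m}" if e: "e \<in> edges ?M" for e
    proof -
      obtain p where "p < m" "e = {Suc (\<sigma> p), Suc (m + p)}" using e by (auto simp: perm_matching_def)
      then show ?thesis using lt[of p] by simp
    qed
    ultimately show "\<exists>P. partition_on (verts ?M) P \<and> finite P \<and> card P = 2
        \<and> (\<forall>I\<in>P. interval_of (verts ?M) I \<and> (\<forall>e\<in>edges ?M. \<not> e \<subseteq> I))"
      using ne verts by (intro exI[of _ "{{1..m}, {m + 1..2 * m}}"]) (auto simp: interval_of_def)
  next
    fix k assume "\<exists>P. partition_on (verts ?M) P \<and> finite P \<and> card P = k
        \<and> (\<forall>I\<in>P. interval_of (verts ?M) I \<and> (\<forall>e\<in>edges ?M. \<not> e \<subseteq> I))"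
    then obtain P where P: "partition_on (verts ?M) P" "finite P" "card P = k" "\<forall>I\<in>P. \<forall>e\<in>edges ?M. \<not> e \<subseteq> I"
      by blast
    have e: "{Suc (\<sigma> 0), Suc m} \<in> edges ?M" using m by (force simp: perm_matching_def)
    moreover have "{Suc (\<sigma> 0), Suc m} \<subseteq> verts ?M" using m lt[of 0] by (auto simp: perm_matching_def)
    ultimately obtain A B where AB: "A \<in> P" "B \<in> P" "Suc (\<sigma> 0) \<in> A" "Suc m \<in> B"
      using P(1) unfolding partition_on_def by (metis UnionE insert_subset)
    then have "A \<noteq> B" using P(4) e by auto
    then have "card {A, B} = 2" by simp
    then show "2 \<le> k" using AB P card_mono[of P "{A, B}"] by simp
  qed
  then show ?thesis using om by (simp add: matchings2_def perm_matching_def)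
qed

lemma inj_on_perm_matching: "inj_on (perm_matching m) {\<sigma>. \<sigma> permutes {..<m}}"
proof (rule inj_onI)
  fix \<sigma> \<tau> assume *: "\<sigma> \<in> {\<sigma>. \<sigma> permutes {..<m}}" "\<tau> \<in> {\<sigma>. \<sigma> permutes {..<m}}"
    "perm_matching m \<sigma> = perm_matching m \<tau>"
  then have p: "\<sigma> permutes {..<m}" "\<tau> permutes {..<m}" by auto
  show "\<sigma> = \<tau>"
  proof
    fix x show "\<sigma> x = \<tau> x"
    proof (cases "x < m")
      case True
      then have "{Suc (\<sigma> x), Suc (m + x)} \<in> edges (perm_matching m \<tau>)"
        unfolding *(3)[symmetric] by (auto simp: perm_matching_def)
      then obtain y where "y < m" "{Suc (\<sigma> x), Suc (m + x)} = {Suc (\<tau> y), Suc (m + y)}"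
        by (auto simp: perm_matching_def)
      moreover have "\<sigma> x < m" "\<tau> y < m"
        using permutes_in_image[OF p(1), of x] permutes_in_image[OF p(2), of y] True \<open>y < m\<close> by auto
      ultimately show ?thesis by (auto simp: doubleton_eq_iff)
    qed (use p in \<open>simp add: permutes_not_in\<close>)
  qed
qed

text \<open>The singletons form an admissible partition, so the \<open>LEAST\<close> in the
  definition is attained.\<close>

lemma interval_chromatic_numberE:
  assumes G: "ordered_graph G" and k: "interval_chromatic_number G = k"
  obtains P where "partition_on (verts G) P" "card P = k"
    "\<And>I. I \<in> P \<Longrightarrow> interval_of (verts G) I" "\<And>I e. I \<in> P \<Longrightarrow> e \<in> edges G \<Longrightarrow> \<not> e \<subseteq> I"
proof -
  let ?Q = "\<lambda>k. \<exists>P. partition_on (verts G) P \<and> finite P \<and> card P = k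
        \<and> (\<forall>I\<in>P. interval_of (verts G) I \<and> (\<forall>e\<in>edges G. \<not> e \<subseteq> I))"
  let ?S = "(\<lambda>v. {v}) ` verts G"
  have "\<not> e \<subseteq> {v}" if "e \<in> edges G" for e v
  proof
    assume "e \<subseteq> {v}"
    then have "card e \<le> card {v}" by (intro card_mono) auto
    then show False using that G by (auto simp: ordered_graph_def nsets_def)
  qed
  then have "?Q (card ?S)" using G
    by (intro exI[of _ ?S]) (auto simp: partition_on_def disjoint_def interval_of_def ordered_graph_def)
  then have "?Q (interval_chromatic_number G)" unfolding interval_chromatic_number_def by (rule LeastI)
  then show thesis using that k by blast
qed

text \<open>With exactly two parts every edge crosses between them, so taking partners is a
  bijection between the parts. They have equal size, the cut lies at \<open>m\<close>, and the
  partners of the right endpoints give \<open>\<sigma>\<close>.\<close>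

lemma matchings2_is_perm_matching:
  assumes "M \<in> matchings2 (2 * m)"
  shows "\<exists>\<sigma>. \<sigma> permutes {..<m} \<and> M = perm_matching m \<sigma>"
proof -
  define V where "V = {1..2 * m}"
  have M: "ordered_graph M" "verts M = V" "interval_chromatic_number M = 2"
    and deg: "\<And>v. v \<in> V \<Longrightarrow> card {e \<in> edges M. v \<in> e} = 1"
    using assms by (auto simp: matchings2_def ordered_matching_def V_def)
  have E: "\<exists>x y. e = {x, y} \<and> x \<in> V \<and> y \<in> V \<and> x \<noteq> y" if "e \<in> edges M" for e
    using that M(1,2) unfolding ordered_graph_def nsets_2_eq by blast
  have uniq: "e = e'" if *: "e \<in> edges M" "e' \<in> edges M" "v \<in> e" "v \<in> e'" "v \<in> V" for e e' v
  proof -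
    obtain f where "{e \<in> edges M. v \<in> e} = {f}" using deg[OF *(5)] card_1_singletonE by metis
    then show ?thesis using * by blast
  qed
  have "\<exists>w. w \<in> V \<and> w \<noteq> v \<and> {v, w} \<in> edges M" if v: "v \<in> V" for v
  proof -
    obtain e where "{e \<in> edges M. v \<in> e} = {e}" using deg[OF v] card_1_singletonE by metis
    then have "e \<in> edges M" "v \<in> e" by auto
    with E[of e] show ?thesis by (auto simp: insert_commute)
  qed
  then obtain nb where nb: "\<And>v. v \<in> V \<Longrightarrow> nb v \<in> V \<and> nb v \<noteq> v \<and> {v, nb v} \<in> edges M" by metis
  have nbI: "w = nb v" if "{v, w} \<in> edges M" "v \<in> V" for v w
    using uniq[OF that(1), of "{v, nb v}" v] nb[OF that(2)] that(2) by (auto simp: doubleton_eq_iff)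
  have nbnb: "nb (nb v) = v" if "v \<in> V" for v
    using nbI[of "nb v" v] nb[OF that] by (simp add: insert_commute)
  obtain P where P: "partition_on V P" "card P = 2" "\<And>I. I \<in> P \<Longrightarrow> interval_of V I"
      "\<And>I e. I \<in> P \<Longrightarrow> e \<in> edges M \<Longrightarrow> \<not> e \<subseteq> I"
    using interval_chromatic_numberE[OF M(1,3)] unfolding M(2) by metis
  obtain I I' where I: "P = {I, I'}" "1 \<in> I" "I \<inter> I' = {}" "I \<union> I' = V"
  proof -
    obtain A B where AB: "P = {A, B}" "A \<noteq> B" using P(2) by (auto simp: card_2_iff)
    then have "A \<inter> B = {}" "A \<union> B = V" "A \<noteq> {}" using P(1) by (auto simp: partition_on_def disjoint_def)
    moreover from this have "1 \<in> V" by (auto simp: V_def)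
    ultimately show thesis using that[of A B] that[of B A] AB(1) by (auto simp: insert_commute)
  qed
  have fin: "finite I" "finite I'" using I(4) by (metis V_def finite_Un finite_atLeastAtMost)+
  define b where "b = Max I"
  have "I \<noteq> {}" using I(2) by blast
  with fin have b: "b \<in> I" "\<And>x. x \<in> I \<Longrightarrow> x \<le> b" by (auto simp: b_def)
  have IV: "I = {1..b}"
  proof
    show "I \<subseteq> {1..b}" using b I(4) by (auto simp: V_def)
    show "{1..b} \<subseteq> I"
    proof
      fix y assume y: "y \<in> {1..b}"
      moreover have "b \<in> V" using b(1) I(4) by auto
      ultimately have "y \<in> V" by (auto simp: V_def)
      then show "y \<in> I" using P(3)[of I] I(1,2) b(1) y unfolding interval_of_def
        by (metis atLeastAtMost_iff insertI1 le_neq_implies_less)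
    qed
  qed
  have cross: "nb v \<in> I' \<longleftrightarrow> v \<in> I" if "v \<in> V" for v
  proof -
    have "\<not> {v, nb v} \<subseteq> I" "\<not> {v, nb v} \<subseteq> I'" using P(4) I(1) nb[OF that] by auto
    moreover have "v \<in> I \<union> I'" "nb v \<in> I \<union> I'" using I(4) that nb[OF that] by auto
    ultimately show ?thesis using I(3) by auto
  qed
  have cross': "nb v \<in> I" if "v \<in> I'" for v
    using cross[of v] nb[of v] that I(3,4) by blast
  have "bij_betw nb I I'"
    using cross cross' nbnb I(4) by (intro bij_betw_byWitness[where f' = nb]) auto
  then have "card I = card I'" by (rule bij_betw_same_card)
  moreover have "card I + card I' = 2 * m" using card_Un_disjoint[OF fin I(3)] I(4) by (simp add: V_def)
  ultimately have "card I = m" by simp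
  then have bm: "b = m" using IV by simp
  have I': "I' = {m + 1..2 * m}"
  proof -
    have "I' = V - I" using I(3,4) by auto
    then show ?thesis using IV bm by (auto simp: V_def)
  qed
  define \<sigma> where "\<sigma> p = (if p < m then nb (Suc (m + p)) - 1 else p)" for p
  have nbS: "nb (Suc (m + p)) = Suc (\<sigma> p)" "\<sigma> p < m" if "p < m" for p
    using cross'[of "Suc (m + p)"] that IV bm I' by (auto simp: \<sigma>_def)
  have "inj_on \<sigma> {..<m}"
  proof (rule inj_onI)
    fix p q assume pq: "p \<in> {..<m}" "q \<in> {..<m}" "\<sigma> p = \<sigma> q"
    then have "nb (nb (Suc (m + p))) = nb (nb (Suc (m + q)))" using nbS by simp
    then show "p = q" using pq nbnb by (simp add: V_def)
  qed
  moreover have "\<sigma> ` {..<m} \<subseteq> {..<m}" using nbS by auto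
  ultimately have "bij_betw \<sigma> {..<m} {..<m}" by (simp add: bij_betw_def endo_inj_surj)
  then have \<sigma>: "\<sigma> permutes {..<m}" by (rule bij_imp_permutes) (simp add: \<sigma>_def)
  have "edges M = (\<lambda>p. {Suc (\<sigma> p), Suc (m + p)}) ` {..<m}"
  proof
    show "(\<lambda>p. {Suc (\<sigma> p), Suc (m + p)}) ` {..<m} \<subseteq> edges M"
    proof (rule image_subsetI)
      fix p assume "p \<in> {..<m}"
      then show "{Suc (\<sigma> p), Suc (m + p)} \<in> edges M"
        using nb[of "Suc (m + p)"] nbS(1)[of p] by (simp add: V_def insert_commute)
    qed
    show "edges M \<subseteq> (\<lambda>p. {Suc (\<sigma> p), Suc (m + p)}) ` {..<m}"
    proof
      fix e assume e: "e \<in> edges M"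
      then obtain x y where xy: "e = {x, y}" "x \<in> V" "y \<in> V" using E by blast
      have "x \<in> I' \<or> y \<in> I'" using P(4)[of I e] I(1,4) xy e by auto
      then obtain v where v: "v \<in> I'" "v \<in> e" using xy by blast
      then have vV: "v \<in> V" using I(4) by auto
      define p where "p = v - Suc m"
      have p: "p < m" "v = Suc (m + p)" using v(1) I' by (auto simp: p_def)
      have "e = {v, nb v}" using uniq[OF e _ v(2) _ vV] nb[OF vV] by blast
      then show "e \<in> (\<lambda>p. {Suc (\<sigma> p), Suc (m + p)}) ` {..<m}"
        using p nbS(1)[OF p(1)] by (auto simp: insert_commute)
    qed
  qed
  then have "M = perm_matching m \<sigma>" using M(2) by (simp add: perm_matching_def V_def prod_eq_iff)
  then show ?thesis using \<sigma> by blast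
qed

lemma card_matchings2:
  assumes "0 < m"
  shows "card (matchings2 (2 * m)) = fact m"
proof -
  have "matchings2 (2 * m) = perm_matching m ` {\<sigma>. \<sigma> permutes {..<m}}"
    using perm_matching_in_matchings2 matchings2_is_perm_matching assms by blast
  then show ?thesis by (simp add: card_image[OF inj_on_perm_matching] card_permutations)
qed

section \<open>The union bound\<close>

text \<open>The first factor counts the tables and the second the lists of \<open>r\<close> blocks
  over one table; for fixed blocks \<open>card_permutes_sorted_blocks\<close> leaves at most
  \<open>fact m / fact e ^ r\<close> permutations. The inequality is multiplied out to stay in the
  natural numbers.\<close>

lemma card_permutes_with_sorted_blocks:
  "card {\<sigma>. \<sigma> permutes {..<m} \<and> has_sorted_blocks m d e r \<sigma>} * fact e ^ r
   \<le> (2 * m) ^ (2 * d * e) * (m * (4 * d) ^ e) ^ r * fact m" (is "card ?A * _ \<le> _")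
proof -
  define TT where "TT = {T. set T \<subseteq> {l. set l \<subseteq> {..<2 * m} \<and> length l = d} \<and> length T = 2 * e}"
  define XX where "XX T = {xss. set xss \<subseteq> blocks m d e T \<and> length xss = r}" for T
  define C where "C xss = {\<sigma>. \<sigma> permutes {..<m} \<and> (\<forall>xs\<in>set xss. length xs = e \<and> sorted (map \<sigma> xs))
     \<and> distinct (concat xss) \<and> set (concat xss) \<subseteq> {..<m}}" for xss
  have C: "card (C xss) * fact e ^ r \<le> fact m" if "length xss = r" for xss
  proof (cases "C xss = {}")
    case False
    then have *: "\<And>xs. xs \<in> set xss \<Longrightarrow> length xs = e" "distinct (concat xss)" "set (concat xss) \<subseteq> {..<m}"
      by (auto simp: C_def)
    then have "C xss = {\<sigma>. \<sigma> permutes {..<m} \<and> (\<forall>xs\<in>set xss. sorted (map \<sigma> xs))}"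
      by (auto simp: C_def)
    then show ?thesis using card_permutes_sorted_blocks[of "{..<m}" xss e] * that by simp
  qed simp
  have fin1: "finite TT" unfolding TT_def by (intro finite_lists_length_eq) simp
  have fin2: "finite (XX T)" for T unfolding XX_def by (intro finite_lists_length_eq finite_blocks)
  note fin = fin1 fin2
  have "card TT = ((2 * m) ^ d) ^ (2 * e)"
    unfolding TT_def by (subst card_lists_length_eq) (simp_all add: finite_lists_length_eq card_lists_length_eq)
  then have cT: "card TT = (2 * m) ^ (2 * d * e)" by (simp only: power_mult[symmetric] mult_ac)
  have cX: "card (XX T) \<le> (m * (4 * d) ^ e) ^ r" for T
  proof -
    have "card (XX T) = card (blocks m d e T) ^ r"
      unfolding XX_def by (rule card_lists_length_eq[OF finite_blocks])
    also have "\<dots> \<le> (m * (4 * d) ^ e) ^ r" by (intro power_mono card_blocks) simp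
    finally show ?thesis .
  qed
  have "?A \<subseteq> (\<Union>T\<in>TT. \<Union>xss\<in>XX T. C xss)"
    unfolding TT_def XX_def C_def has_sorted_blocks_def by blast
  moreover have "finite (\<Union>T\<in>TT. \<Union>xss\<in>XX T. C xss)"
  proof -
    have "finite (C xss)" for xss
      using finite_permutations[of "{..<m}"] by (rule rev_finite_subset) (auto simp: C_def)
    then show ?thesis using fin by blast
  qed
  ultimately have "card ?A \<le> card (\<Union>T\<in>TT. \<Union>xss\<in>XX T. C xss)" by (intro card_mono)
  also have "\<dots> \<le> (\<Sum>T\<in>TT. card (\<Union>xss\<in>XX T. C xss))" by (rule card_UN_le[OF fin(1)])
  also have "\<dots> \<le> (\<Sum>T\<in>TT. \<Sum>xss\<in>XX T. card (C xss))" by (intro sum_mono card_UN_le fin)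
  finally have "card ?A * fact e ^ r \<le> (\<Sum>T\<in>TT. \<Sum>xss\<in>XX T. card (C xss)) * fact e ^ r" by simp
  also have "\<dots> = (\<Sum>T\<in>TT. \<Sum>xss\<in>XX T. card (C xss) * fact e ^ r)" by (simp add: sum_distrib_right)
  also have "\<dots> \<le> (\<Sum>T\<in>TT. \<Sum>xss\<in>XX T. fact m)" by (intro sum_mono C) (simp add: XX_def)
  also have "\<dots> \<le> (\<Sum>T\<in>TT. (m * (4 * d) ^ e) ^ r * fact m)" using cX by (intro sum_mono) simp
  also have "\<dots> = (2 * m) ^ (2 * d * e) * (m * (4 * d) ^ e) ^ r * fact m" by (simp add: cT)
  finally show ?thesis .
qed

text \<open>A uniform matching corresponds to a uniform permutation, and a matching with larger
  Ramsey number comes from a permutation with sorted blocks, which the union bound counts.\<close>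

lemma prob_ordered_ramsey_le:
  assumes m: "0 < m" and t: "2 * m \<le> (d + 1) * t"
    and L: "2 * e * (2 * m * d + 1) + 4 * m \<le> 2 * m * t" and r: "4 * d * e * r \<le> m"
  shows "1 - real ((2 * m) ^ (2 * d * e) * (m * (4 * d) ^ e) ^ r) / fact e ^ r
     \<le> measure_pmf.prob (pmf_of_set (matchings2 (2 * m)))
          {M. ordered_ramsey M (complete_ograph 3) \<le> 4 * m * t}"
proof -
  let ?G = "{M. ordered_ramsey M (complete_ograph 3) \<le> 4 * m * t}" and ?S = "matchings2 (2 * m)"
  let ?A = "{\<sigma>. \<sigma> permutes {..<m} \<and> has_sorted_blocks m d e r \<sigma>}"
  let ?K = "(2 * m) ^ (2 * d * e) * (m * (4 * d) ^ e) ^ r"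
  have "?S - ?G \<subseteq> perm_matching m ` ?A"
  proof
    fix M assume M: "M \<in> ?S - ?G"
    then obtain \<sigma> where \<sigma>: "\<sigma> permutes {..<m}" "M = perm_matching m \<sigma>"
      using matchings2_is_perm_matching by blast
    \<comment> \<open>If the least \<open>N\<close> exceeds \<open>4 * m * t\<close>, then this
      positive number itself fails, which yields an avoiding colouring.\<close>
    have "0 < 4 * m * t" using m t by (cases t) auto
    then have "\<not> (\<forall>col. mono_copy col Red M (4 * m * t) \<or> mono_copy col Blue (complete_ograph 3) (4 * m * t))"
      using M Least_le[of "\<lambda>N. 0 < N \<and> (\<forall>col. mono_copy col Red M N \<or> mono_copy col Blue (complete_ograph 3) N)" "4 * m * t"]
      by (auto simp: ordered_ramsey_def)
    then obtain col where "\<not> mono_copy col Red (perm_matching m \<sigma>) (4 * m * t)"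
      "\<not> mono_copy col Blue (complete_ograph 3) (4 * m * t)" unfolding \<sigma>(2) by blast
    from has_sorted_blocks_if_avoiding[OF \<sigma>(1) m t L r this] show "M \<in> perm_matching m ` ?A"
      unfolding \<sigma>(2) using \<sigma>(1) by (intro imageI CollectI conjI)
  qed
  moreover have "finite ?A" using finite_permutations[of "{..<m}"] by (rule rev_finite_subset) auto
  ultimately have "card (?S - ?G) \<le> card ?A" by (meson card_image_le card_mono finite_imageI le_trans)
  then have "card (?S - ?G) * fact e ^ r \<le> card ?A * fact e ^ r" by (rule mult_right_mono) simp
  also have "\<dots> \<le> ?K * fact m" by (rule card_permutes_with_sorted_blocks)
  finally have "real (card (?S - ?G) * fact e ^ r) \<le> real (?K * fact m)" by (simp only: of_nat_le_iff)
  then have bad: "real (card (?S - ?G)) / fact m \<le> real ?K / fact e ^ r"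
    by (simp add: field_simps)
  have "card ?S = card (?S \<inter> ?G) + card (?S - ?G)"
    by (subst card_Un_disjoint[symmetric]) (auto simp: finite_matchings2 Int_Diff_Un)
  then have "real (fact m) = real (card (?S \<inter> ?G)) + real (card (?S - ?G))"
    unfolding card_matchings2[OF m] by (simp only: of_nat_add)
  then have "real (card (?S \<inter> ?G)) = fact m - real (card (?S - ?G))" by simp
  then have "real (card (?S \<inter> ?G)) / fact m = 1 - real (card (?S - ?G)) / fact m"
    by (simp add: diff_divide_distrib)
  then show ?thesis
    using bad card_matchings2[OF m] measure_pmf_of_set[OF matchings2_nonempty[OF m] finite_matchings2, of ?G]
    by simp
qed

section \<open>Numerical estimates for the choice of parameters\<close>

lemma power_self_le_fact: "n ^ n \<le> 3 ^ n * (fact n :: nat)"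
proof -
  \<comment> \<open>\<open>n ^ n / n!\<close> is a single term of the series of
    \<open>exp n\<close>.\<close>
  have "(\<Sum>k\<in>{n}. real n ^ k /\<^sub>R fact k) \<le> (\<Sum>k. real n ^ k /\<^sub>R fact k)"
    by (rule sum_le_suminf[OF summable_exp_generic]) auto
  then have "real n ^ n / fact n \<le> exp (real n)" by (simp add: exp_def divide_inverse mult.commute)
  also have "\<dots> = exp 1 ^ n" by (simp add: exp_of_nat_mult[symmetric])
  also have "\<dots> \<le> 3 ^ n" by (intro power_mono exp_le) simp
  finally have "real (n ^ n) \<le> real (3 ^ n * fact n)" by (simp add: field_simps)
  then show ?thesis by (simp only: of_nat_le_iff)
qed

text \<open>Apart from the powers of \<open>4 * w^2\<close>, the left side is at most
  \<open>w ^ (20 * w ^ 5)\<close>: 18 comes from the tables, 1 from the shifts of the blocks and 1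
  from the extra factor \<open>w\<close>, which leaves the failure probability
  \<open>1 / w\<close>.\<close>

lemma block_count_le:
  fixes w m :: nat
  assumes w: "512 \<le> w" and m: "2 * m \<le> 512 * w ^ 8"
  shows "(2 * m) ^ (2 * w^2 * w^3) * (m * (4 * w^2) ^ (w^3)) ^ (60 * w^2) * w
     \<le> fact (w ^ 3) ^ (60 * w^2)"
proof -
  have w1: "1 \<le> w" using w by simp
  have w5: "2 * w^2 * w^3 = 2 * w ^ 5" "w ^ 3 * (30 * w^2) = 30 * w ^ 5"
    "w ^ 3 * (60 * w^2) = 2 * (30 * w ^ 5)"
    by (simp_all add: mult.assoc mult.left_commute[of _ 30] mult.left_commute[of _ 60] power_add[symmetric])
  have "512 * w ^ 8 \<le> w * w ^ 8" using w by simp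
  also have "w * w ^ 8 = w ^ 9" by (simp add: eval_nat_numeral)
  finally have m9: "2 * m \<le> w ^ 9" using m by simp
  have "(2 * m) ^ (2 * w^2 * w^3) \<le> (w ^ 9) ^ (2 * w^2 * w^3)" by (rule power_mono[OF m9]) simp
  also have "\<dots> = w ^ (18 * w ^ 5)" unfolding power_mult[symmetric] w5 by simp
  finally have 1: "(2 * m) ^ (2 * w^2 * w^3) \<le> w ^ (18 * w ^ 5)" .
  have "m ^ (60 * w^2) \<le> (w ^ 9) ^ (60 * w^2)" using m9 by (intro power_mono) auto
  also have "\<dots> = w ^ (540 * w^2)" by (simp add: power_mult[symmetric])
  also have "\<dots> \<le> w ^ (w ^ 5)"
  proof (rule power_increasing[OF _ w1])
    have "540 * w^2 \<le> (512 * 512 * 512) * w^2" by simp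
    also have "\<dots> \<le> (w * w * w) * w^2" using w by (intro mult_le_mono order_refl)
    also have "\<dots> = w ^ 5" by (simp add: eval_nat_numeral)
    finally show "540 * w^2 \<le> w ^ 5" .
  qed
  finally have 2: "m ^ (60 * w^2) \<le> w ^ (w ^ 5)" .
  have 3: "w \<le> w ^ (w ^ 5)" using w1 by (intro self_le_power) auto
  \<comment> \<open>For \<open>k = w ^ 3\<close>, \<open>k! \<ge> (k / 3) ^ k\<close> gives
    \<open>(k!)^2 \<ge> (w ^ 6 / 9) ^ k\<close>, and \<open>w \<ge> 144\<close> makes this at least
    \<open>(16 * w ^ 5) ^ k\<close>.\<close>
  have fact_sq: "(16 * w ^ 5) ^ (w ^ 3) \<le> (fact (w ^ 3))\<^sup>2"
  proof -
    define k where "k = w ^ 3"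
    have "9 ^ k * (16 * w ^ 5) ^ k = (9 * (16 * w ^ 5)) ^ k" by (rule power_mult_distrib[symmetric])
    also have "\<dots> \<le> (w ^ 6) ^ k"
    proof (rule power_mono)
      have "9 * (16 * w ^ 5) \<le> w * w ^ 5" using w by simp
      then show "9 * (16 * w ^ 5) \<le> w ^ 6" by (simp add: eval_nat_numeral)
    qed simp
    also have "(w ^ 6) ^ k = w ^ (6 * k)" by (rule power_mult[symmetric])
    also have "6 * k = 3 * k * 2" by simp
    also have "w ^ (3 * k * 2) = (k ^ k)\<^sup>2" by (simp only: power_mult k_def)
    also have "\<dots> \<le> (3 ^ k * fact k)\<^sup>2" by (intro power_mono power_self_le_fact) simp
    also have "\<dots> = (3 ^ k)\<^sup>2 * (fact k)\<^sup>2" by (rule power_mult_distrib)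
    also have "(3 ^ k)\<^sup>2 = ((3::nat)\<^sup>2) ^ k" by (simp only: power_mult[symmetric] mult.commute[of k 2])
    finally have "9 ^ k * (16 * w ^ 5) ^ k \<le> 9 ^ k * (fact k)\<^sup>2" by simp
    then have "(16 * w ^ 5) ^ k \<le> (fact k)\<^sup>2" by (subst (asm) mult_le_cancel1) simp
    then show ?thesis unfolding k_def .
  qed
  have "(2 * m) ^ (2 * w^2 * w^3) * (m * (4 * w^2) ^ (w^3)) ^ (60 * w^2) * w
      = (2 * m) ^ (2 * w^2 * w^3) * m ^ (60 * w^2) * w * ((4 * w^2) ^ (w^3)) ^ (60 * w^2)"
    by (simp add: power_mult_distrib mult_ac)
  also have "\<dots> \<le> w ^ (18 * w ^ 5) * w ^ (w ^ 5) * w ^ (w ^ 5) * ((4 * w^2) ^ (w^3)) ^ (60 * w^2)"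
    using 1 2 3 by (intro mult_le_mono order_refl)
  also have "w ^ (18 * w ^ 5) * w ^ (w ^ 5) * w ^ (w ^ 5) = w ^ (20 * w ^ 5)"
    by (simp add: power_add[symmetric])
  \<comment> \<open>The exponent 30 supplies one factor \<open>w\<close> for each
    \<open>(4 * w^2)^2\<close>, and their product is the base \<open>16 * w ^ 5\<close> of
    \<open>fact_sq\<close>.\<close>
  also have "\<dots> \<le> w ^ (30 * w ^ 5)" by (rule power_increasing[OF _ w1]) simp
  also have "w ^ (30 * w ^ 5) * ((4 * w^2) ^ (w^3)) ^ (60 * w^2) = ((16 * w ^ 5) ^ (w ^ 3)) ^ (30 * w^2)"
  proof -
    have "16 * w ^ 5 = w * (4 * w^2)^2" by algebra
    moreover have "w ^ c * (4 * w^2) ^ (2 * c) = (w * (4 * w^2)^2) ^ c" for c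
      by (simp only: power_mult_distrib power_mult)
    ultimately show ?thesis unfolding power_mult[symmetric] w5 by (simp only:)
  qed
  also have "\<dots> \<le> ((fact (w ^ 3))\<^sup>2) ^ (30 * w^2)" by (intro power_mono fact_sq) simp
  also have "\<dots> = fact (w ^ 3) ^ (60 * w^2)" by (simp add: power_mult[symmetric])
  finally show ?thesis by simp
qed

lemma prob_ramsey_le_powr:
  fixes w m :: nat
  assumes w: "512 \<le> w" and lo: "w ^ 8 \<le> m" and hi: "m \<le> (w + 1) ^ 8"
  shows "1 - 1 / real w \<le> measure_pmf.prob (pmf_of_set (matchings2 (2 * m)))
      {M. real (ordered_ramsey M (complete_ograph 3)) \<le> 2048 * real (2 * m) powr (7/4)}"
proof -
  \<comment> \<open>This costs a factor \<open>2 ^ 8\<close>; together with the 2 in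
    \<open>2 * m\<close> it is the 512 in \<open>t = 512 * w ^ 6\<close>, and \<open>4 * 512\<close>
    is the constant 2048.\<close>
  have "(w + 1) ^ 8 \<le> (2 * w) ^ 8" using w by (intro power_mono) auto
  then have m: "2 * m \<le> 512 * w ^ 8" using hi by (simp add: power_mult_distrib)
  have "0 < w ^ 8" using w by simp
  then have m0: "0 < m" using lo by linarith
  let ?K = "(2 * m) ^ (2 * w^2 * w^3) * (m * (4 * w^2) ^ (w^3)) ^ (60 * w^2)"
  have "real (?K * w) \<le> real (fact (w ^ 3) ^ (60 * w^2))"
    using block_count_le[OF w m] by (simp only: of_nat_le_iff)
  then have "real ?K * real w \<le> fact (w ^ 3) ^ (60 * w^2)" by simp
  then have "real ?K / fact (w ^ 3) ^ (60 * w^2) \<le> 1 / real w" using w by (simp add: field_simps)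
  then have "1 - 1 / real w \<le> 1 - real ?K / fact (w ^ 3) ^ (60 * w^2)" by simp
  also have "\<dots> \<le> measure_pmf.prob (pmf_of_set (matchings2 (2 * m)))
          {M. ordered_ramsey M (complete_ograph 3) \<le> 4 * m * (512 * w ^ 6)}"
  proof (rule prob_ordered_ramsey_le[OF m0])
    have "512 * w ^ 8 \<le> (w^2 + 1) * (512 * w ^ 6)" by (simp add: algebra_simps power_add[symmetric])
    then show "2 * m \<le> (w^2 + 1) * (512 * w ^ 6)" using m by simp
    have "w ^ 5 \<le> w ^ 6" "w ^ 3 \<le> w ^ 6" "1 \<le> w ^ 6" using w by (auto intro!: power_increasing)
    then have "m * w ^ 5 \<le> m * w ^ 6" "1 * w ^ 3 \<le> m * w ^ 6" "m * 1 \<le> m * w ^ 6"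
      using m0 by (intro mult_le_mono; simp)+
    moreover have "2 * w ^ 3 * (2 * m * w^2 + 1) + 4 * m = 4 * (m * w ^ 5) + 2 * w ^ 3 + 4 * m"
      by (simp add: algebra_simps power_add[symmetric])
    ultimately show "2 * w ^ 3 * (2 * m * w^2 + 1) + 4 * m \<le> 2 * m * (512 * w ^ 6)" by linarith
    have "4 * w^2 * w ^ 3 * (60 * w^2) = 240 * w ^ 7" by (simp add: power_add[symmetric])
    also have "\<dots> \<le> w * w ^ 7" using w by simp
    also have "\<dots> = w ^ 8" by (simp add: eval_nat_numeral)
    finally show "4 * w^2 * w ^ 3 * (60 * w^2) \<le> m" using lo by simp
  qed
  also have "\<dots> \<le> measure_pmf.prob (pmf_of_set (matchings2 (2 * m)))
      {M. real (ordered_ramsey M (complete_ograph 3)) \<le> 2048 * real (2 * m) powr (7/4)}"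
  proof (rule measure_pmf.finite_measure_mono)
    \<comment> \<open>The lower bound on \<open>m\<close> gives
      \<open>w ^ 6 = (w ^ 8) powr (3/4) \<le> m powr (3/4)\<close>, so \<open>4 * m * t\<close> is
      of order \<open>m powr (7/4)\<close>.\<close>
    have "real w ^ 6 = real w powr (8 * (3/4))" using w by (simp add: powr_numeral)
    also have "\<dots> = (real w powr 8) powr (3/4)" by (simp only: powr_powr)
    also have "real w powr 8 = real (w ^ 8)" using w by (simp add: powr_numeral)
    also have "real (w ^ 8) powr (3/4) \<le> real m powr (3/4)" using lo by (intro powr_mono2) (simp_all only: of_nat_le_iff of_nat_0_le_iff)
    finally have "real m * real w ^ 6 \<le> real m powr 1 * real m powr (3/4)" using m0 by simp
    also have "\<dots> = real m powr (7/4)" by (simp only: powr_add[symmetric]) simp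
    also have "\<dots> \<le> real (2 * m) powr (7/4)" by (intro powr_mono2) auto
    finally have "real (4 * m * (512 * w ^ 6)) \<le> 2048 * real (2 * m) powr (7/4)" by simp
    then show "{M. ordered_ramsey M (complete_ograph 3) \<le> 4 * m * (512 * w ^ 6)} \<subseteq>
      {M. real (ordered_ramsey M (complete_ograph 3)) \<le> 2048 * real (2 * m) powr (7/4)}"
      by (auto intro: order_trans[OF of_nat_mono])
  qed simp
  finally show ?thesis .
qed

section \<open>The limit along even \<open>n\<close>\<close>

lemma powr_eighth_power: "0 \<le> x \<Longrightarrow> (x powr (1/8)) ^ 8 = (x::real)"
  using powr_realpow[of "x powr (1/8)" 8, symmetric] by (cases "x = 0") (simp_all add: powr_powr)

theorem theorem4:
  "\<exists>c::real.
     ((\<lambda>n. measure_pmf.prob (pmf_of_set (matchings2 n))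
             {M. real (ordered_ramsey M (complete_ograph 3)) \<le> c * real n powr (7/4)})
        \<longlongrightarrow> 1) (inf at_top (principal {n::nat. even n}))"
proof
  \<comment> \<open>The rounded-down eighth root of \<open>m = n div 2\<close>, so that
    \<open>w n ^ 8 \<le> m \<le> (w n + 1) ^ 8\<close>.\<close>
  define w where "w n = nat \<lfloor>real (n div 2) powr (1/8)\<rfloor>" for n :: nat
  have w: "filterlim w at_top at_top"
    unfolding filterlim_at_top eventually_sequentially
  proof (intro allI exI impI)
    fix Z n :: nat
    assume "2 * Z ^ 8 \<le> n"
    then have "Z ^ 8 \<le> n div 2" by simp
    then have "real (Z ^ 8) \<le> real (n div 2)" by (simp only: of_nat_le_iff)
    then have "real Z ^ 8 \<le> real (n div 2)" by (simp only: of_nat_power)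
    then have "(real Z ^ 8) powr (1/8) \<le> real (n div 2) powr (1/8)" by (intro powr_mono2) auto
    moreover have "((real Z ^ 8) powr (1/8)) ^ 8 = real Z ^ 8" by (rule powr_eighth_power) simp
    then have "(real Z ^ 8) powr (1/8) = real Z" by (rule power_eq_imp_eq_base) auto
    ultimately show "Z \<le> w n" unfolding w_def by (intro le_nat_floor) simp
  qed
  have "((\<lambda>n. 1 / real (w n)) \<longlongrightarrow> 0) at_top" by (rule filterlim_compose[OF lim_1_over_n w])
  then have "((\<lambda>n. 1 - 1 / real (w n)) \<longlongrightarrow> 1 - 0) at_top" by (intro tendsto_diff tendsto_const)
  then have lim: "((\<lambda>n. 1 - 1 / real (w n)) \<longlongrightarrow> 1) (inf at_top (principal {n. even n}))"
    by (intro tendsto_mono[OF inf_le1]) simp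
  have "eventually (\<lambda>n. 512 \<le> w n) at_top"
    using w by (simp add: filterlim_at_top)
  then have lower: "\<forall>\<^sub>F n in inf at_top (principal {n. even n}). 1 - 1 / real (w n) \<le>
      measure_pmf.prob (pmf_of_set (matchings2 n))
        {M. real (ordered_ramsey M (complete_ograph 3)) \<le> 2048 * real n powr (7/4)}"
    unfolding eventually_inf_principal
  proof (rule eventually_mono, intro impI)
    fix n assume n: "512 \<le> w n" "n \<in> {n::nat. even n}"
    define m where "m = n div 2"
    have nm: "n = 2 * m" using n(2) by (simp add: m_def)
    have wm: "w n = nat \<lfloor>real m powr (1/8)\<rfloor>" by (simp add: w_def m_def)
    have m8: "(real m powr (1/8)) ^ 8 = real m" by (rule powr_eighth_power) simp
    have "real (w n) \<le> real m powr (1/8)" unfolding wm by simp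
    then have "real (w n) ^ 8 \<le> (real m powr (1/8)) ^ 8" by (intro power_mono) auto
    then have "real (w n) ^ 8 \<le> real m" unfolding m8 .
    then have "w n ^ 8 \<le> m" by (simp only: of_nat_power[symmetric] of_nat_le_iff)
    moreover have "real m powr (1/8) \<le> real (w n + 1)" unfolding wm by linarith
    then have "(real m powr (1/8)) ^ 8 \<le> real (w n + 1) ^ 8" by (intro power_mono) auto
    then have "real m \<le> real (w n + 1) ^ 8" unfolding m8 .
    then have "m \<le> (w n + 1) ^ 8" by (simp only: of_nat_power[symmetric] of_nat_le_iff)
    ultimately show "1 - 1 / real (w n) \<le> measure_pmf.prob (pmf_of_set (matchings2 n))
        {M. real (ordered_ramsey M (complete_ograph 3)) \<le> 2048 * real n powr (7/4)}"
      using prob_ramsey_le_powr[OF n(1)] unfolding nm by blast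
  qed
  show "((\<lambda>n. measure_pmf.prob (pmf_of_set (matchings2 n))
           {M. real (ordered_ramsey M (complete_ograph 3)) \<le> 2048 * real n powr (7/4)})
      \<longlongrightarrow> 1) (inf at_top (principal {n. even n}))"
    by (rule tendsto_sandwich[OF lower _ lim tendsto_const]) (simp add: measure_pmf.prob_le_1)
qed

end
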